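(* There exist universal constants $c_0,C_0>0$ such that, for all integers $d\ge1$ and $n\ge2$, $$c_0\min\{d,\log(n+1)\}\le\Gamma_{d,n}\le\min\left\{2d+\frac12,\;1+\frac14\log(n-1)\right\}\le C_0\min\{d,\log(n+1)\},$$ where $\Gamma_{d,n}$ is the worst-case normalized terminal excursion from a minimizer (defined in the context). Moreover, for every integer $d\ge 1$, let $A_d^\star$ be the smallest $A\ge0$ such that, for every horizon $n\ge1$, every instance $(\mathcal{X},f,L)$ in $\mathbb{R}^d$, every stepsize $\eta>0$, every initialization $x_1\in\mathcal{X}$, and every admissible trajectory $(x_k)_{k=1}^n$, $$f(x_n)-f_\star\le A\,\eta L^2+\frac{\operatorname{dist}(x_1,\mathcal{X}_\star)^2}{2n\eta}.$$ Then $$\max\left\{1,\frac14\left\lfloor\frac{d-1}{2}\right\rfloor\right\}\le A_d^\star\le2d+\frac12,$$ and therefore $A_d^\star=\Theta(d)$, i.e. there are universal constants $c,C>0$ with $c\,d\le A_d^\star\le C\,d$ for all $d\ge1$.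
   Context: All logarithms are natural. $\lVert\cdot\rVert$ and $\langle\cdot,\cdot\rangle$ are the Euclidean norm and inner product on $\mathbb{R}^d$; $\Pi_S$ is Euclidean projection onto a nonempty closed convex set $S$ and $\operatorname{dist}(x,S)=\inf_{z\in S}\lVert x-z\rVert$. $\partial f(x)$ is the set of $g\in\mathbb{R}^d$ with $f(y)\ge f(x)+\langle g,y-x\rangle$ for every $y\in\mathbb{R}^d$. An instance in $\mathbb{R}^d$ is a triple $(\mathcal{X},f,L)$ where $\mathcal{X}\subseteq\mathbb{R}^d$ is nonempty, closed and convex, $L\ge0$, $f:\mathbb{R}^d\to\mathbb{R}$ is convex and globally $L$-Lipschitz ($|f(x)-f(y)|\le L\lVert x-y\rVert$ for all $x,y\in\mathbb{R}^d$; $L$ need not be minimal), and $\mathcal{X}_\star:=\operatorname*{argmin}_{x\in\mathcal{X}}f(x)$ is nonempty; put $f_\star:=\min_{x\in\mathcal{X}}f(x)$. Given a stepsize $\eta>0$, a horizon $n$ and $x_1\in\mathcal{X}$, an admissible trajectory is any sequence $(x_k)_{k=1}^n$ with $x_{k+1}=\Pi_{\mathcal{X}}(x_k-\eta g_k)$ for some $g_k\in\partial f(x_k)$, $1\le k<n$. For $d\ge1$ and $n\ge2$, $$\Gamma_{d,n}:=\sup\frac{f(x_n)-f_\star}{\eta L^2},$$ where the supremum ranges over all $\eta,L>0$, all instances $(\mathcal{X},f,L)$ in $\mathbb{R}^d$, all initializations $x_1\in\mathcal{X}_\star$, and all admissible trajectories $(x_k)_{k=1}^n$ starting at $x_1$.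 *)

theory Defs
  imports "HOL-Analysis.Analysis"
begin

text \<open>
  Constants that are uniform in the dimension require all Euclidean spaces to live in one type.
  We use the inner product space of finitely supported real sequences; the space of dimension
  \<open>d\<close> is its coordinate subspace \<open>Rd d\<close>, which carries exactly the usual inner product
  (\<open>inner_Rd\<close>) and is a closed subset (\<open>closed_Rd\<close>), so that \<^const>\<open>closed\<close> agrees with
  closedness relative to \<open>Rd d\<close> for subsets of \<open>Rd d\<close>.
\<close>

typedef fseq = "{x :: nat \<Rightarrow> real. finite {i. x i \<noteq> 0}}"
  morphisms coord Abs_fseq
  by (rule exI[of _ "\<lambda>_. 0"]) simp

lemma finite_coord: "finite {i. coord x i \<noteq> 0}"
  using coord[of x] by simp

lemma coord_Abs: "finite {i. f i \<noteq> 0} \<Longrightarrow> coord (Abs_fseq f) = f"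
  by (simp add: Abs_fseq_inverse)

lemma fseq_eqI: "(\<And>i. coord x i = coord y i) \<Longrightarrow> x = y"
  by (metis coord_inject ext)

instantiation fseq :: real_vector
begin

definition zero_fseq :: fseq where
  "0 = Abs_fseq (\<lambda>_. 0)"
definition plus_fseq :: "fseq \<Rightarrow> fseq \<Rightarrow> fseq" where
  "x + y = Abs_fseq (\<lambda>i. coord x i + coord y i)"
definition uminus_fseq :: "fseq \<Rightarrow> fseq" where
  "- x = Abs_fseq (\<lambda>i. - coord x i)"
definition minus_fseq :: "fseq \<Rightarrow> fseq \<Rightarrow> fseq" where
  "x - y = Abs_fseq (\<lambda>i. coord x i - coord y i)"
definition scaleR_fseq :: "real \<Rightarrow> fseq \<Rightarrow> fseq" where
  "r *\<^sub>R x = Abs_fseq (\<lambda>i. r * coord x i)"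
lemma coord_zero: "coord 0 i = 0"
  by (simp add: zero_fseq_def coord_Abs)

lemma coord_plus: "coord (x + y) i = coord x i + coord y i"
proof -
  have "finite {i. coord x i + coord y i \<noteq> 0}"
    by (rule finite_subset[OF _ finite_UnI[OF finite_coord[of x] finite_coord[of y]]]) auto
  then show ?thesis by (simp add: plus_fseq_def coord_Abs)
qed

lemma coord_uminus: "coord (- x) i = - coord x i"
  using finite_coord[of x] by (simp add: uminus_fseq_def coord_Abs)

lemma coord_minus: "coord (x - y) i = coord x i - coord y i"
proof -
  have "finite {i. coord x i - coord y i \<noteq> 0}"
    by (rule finite_subset[OF _ finite_UnI[OF finite_coord[of x] finite_coord[of y]]]) auto
  then show ?thesis by (simp add: minus_fseq_def coord_Abs)
qed

lemma coord_scaleR: "coord (r *\<^sub>R x) i = r * coord x i"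
proof -
  have "finite {i. r * coord x i \<noteq> 0}"
    by (rule finite_subset[OF _ finite_coord[of x]]) auto
  then show ?thesis by (simp add: scaleR_fseq_def coord_Abs)
qed

lemmas coord_simps = coord_zero coord_plus coord_uminus coord_minus coord_scaleR

instance
proof
  fix x y z :: fseq and a b :: real
  show "x + y + z = x + (y + z)" by (rule fseq_eqI) (simp add: coord_simps)
  show "x + y = y + x" by (rule fseq_eqI) (simp add: coord_simps)
  show "0 + x = x" by (rule fseq_eqI) (simp add: coord_simps)
  show "- x + x = 0" by (rule fseq_eqI) (simp add: coord_simps)
  show "x - y = x + - y" by (rule fseq_eqI) (simp add: coord_simps)
  show "a *\<^sub>R (x + y) = a *\<^sub>R x + a *\<^sub>R y"
    by (rule fseq_eqI) (simp add: coord_simps algebra_simps)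
  show "(a + b) *\<^sub>R x = a *\<^sub>R x + b *\<^sub>R x"
    by (rule fseq_eqI) (simp add: coord_simps algebra_simps)
  show "a *\<^sub>R b *\<^sub>R x = (a * b) *\<^sub>R x" by (rule fseq_eqI) (simp add: coord_simps)
  show "1 *\<^sub>R x = x" by (rule fseq_eqI) (simp add: coord_simps)
qed

end

instantiation fseq :: real_inner
begin

definition inner_fseq :: "fseq \<Rightarrow> fseq \<Rightarrow> real" where
  "inner x y = (\<Sum>i | coord x i \<noteq> 0. coord x i * coord y i)"
definition norm_fseq :: "fseq \<Rightarrow> real" where
  "norm (x :: fseq) = sqrt (inner x x)"
definition sgn_fseq :: "fseq \<Rightarrow> fseq" where
  "sgn (x :: fseq) = x /\<^sub>R norm x"
definition dist_fseq :: "fseq \<Rightarrow> fseq \<Rightarrow> real" where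
  "dist (x :: fseq) y = norm (x - y)"
definition uniformity_fseq :: "(fseq \<times> fseq) filter" where
  "uniformity = (INF e\<in>{0<..}. principal {(x, y :: fseq). dist x y < e})"
definition open_fseq :: "fseq set \<Rightarrow> bool" where
  "open (U :: fseq set) \<longleftrightarrow>
     (\<forall>x\<in>U. \<forall>\<^sub>F (x', y) in uniformity. x' = x \<longrightarrow> y \<in> U)"

lemma inner_fseq_superset:
  assumes "finite S" "{i. coord x i \<noteq> 0} \<subseteq> S"
  shows "inner x y = (\<Sum>i\<in>S. coord x i * coord y i)"
  unfolding inner_fseq_def by (rule sum.mono_neutral_left) (use assms in auto)

instance
proof
  fix x y z :: fseq and r :: real
  show "sgn x = x /\<^sub>R norm x" by (rule sgn_fseq_def)
  show "dist x y = norm (x - y)" by (rule dist_fseq_def)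
  show "uniformity = (INF e\<in>{0<..}. principal {(x, y :: fseq). dist x y < e})"
    by (rule uniformity_fseq_def)
  show "open U \<longleftrightarrow> (\<forall>x\<in>U. \<forall>\<^sub>F (x', y) in uniformity. x' = x \<longrightarrow> y \<in> U)"
    for U :: "fseq set"
    by (rule open_fseq_def)
  define S where "S = {i. coord x i \<noteq> 0} \<union> {i. coord y i \<noteq> 0}"
  have S: "finite S" unfolding S_def by (simp add: finite_coord)
  have sub: "{i. coord x i \<noteq> 0} \<subseteq> S" "{i. coord y i \<noteq> 0} \<subseteq> S"
    "{i. coord (x + y) i \<noteq> 0} \<subseteq> S" "{i. coord (r *\<^sub>R x) i \<noteq> 0} \<subseteq> S"
    by (auto simp: S_def coord_simps)
  note inner_S = inner_fseq_superset[OF S]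
  show "inner x y = inner y x"
    by (simp add: inner_S[OF sub(1)] inner_S[OF sub(2)] mult.commute)
  show "inner (x + y) z = inner x z + inner y z"
    by (simp add: inner_S[OF sub(1)] inner_S[OF sub(2)] inner_S[OF sub(3)]
        coord_simps distrib_right sum.distrib)
  show "inner (r *\<^sub>R x) y = r * inner x y"
    by (simp add: inner_S[OF sub(1)] inner_S[OF sub(4)] coord_simps sum_distrib_left mult.assoc)
  show "0 \<le> inner x x" unfolding inner_fseq_def by (rule sum_nonneg) simp
  show "inner x x = 0 \<longleftrightarrow> x = 0"
  proof
    assume "inner x x = 0"
    then have "\<forall>i\<in>{i. coord x i \<noteq> 0}. coord x i * coord x i = 0"
      unfolding inner_fseq_def by (subst (asm) sum_nonneg_eq_0_iff) (auto simp: finite_coord)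
    then have "coord x i = 0" for i by auto
    then show "x = 0" by (intro fseq_eqI) (simp add: coord_simps)
  qed (simp add: inner_fseq_def coord_simps)
  show "norm x = sqrt (inner x x)" by (rule norm_fseq_def)
qed

end

definition Rd :: "nat \<Rightarrow> fseq set" where
  "Rd d = {x. \<forall>i\<ge>d. coord x i = 0}"

lemma inner_Rd:
  assumes "x \<in> Rd d"
  shows "inner x y = (\<Sum>i<d. coord x i * coord y i)"
proof (rule inner_fseq_superset)
  show "{i. coord x i \<noteq> 0} \<subseteq> {..<d}"
    using assms by (auto simp: Rd_def) (metis leI)
qed simp

lemma bij_betw_Rd: "bij_betw coord (Rd d) {v. \<forall>i\<ge>d. v i = 0}"
proof (rule bij_betw_byWitness[where f' = Abs_fseq])
  have *: "finite {i. v i \<noteq> 0}" if "\<forall>i\<ge>d. v i = 0" for v :: "nat \<Rightarrow> real"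
    by (rule finite_subset[of _ "{..<d}"]) (use that in \<open>auto simp: not_less[symmetric]\<close>)
  show "\<forall>v\<in>{v. \<forall>i\<ge>d. v i = 0}. coord (Abs_fseq v) = v"
    by (simp add: * coord_Abs)
  show "Abs_fseq ` {v. \<forall>i\<ge>d. v i = 0} \<subseteq> Rd d"
    by (auto simp: * coord_Abs Rd_def)
qed (auto simp: Rd_def coord_inverse)

lemma abs_coord_le_norm: "\<bar>coord x i\<bar> \<le> norm x"
proof -
  have "(coord x i)\<^sup>2 \<le> inner x x"
  proof (cases "coord x i = 0")
    case False
    then have "coord x i * coord x i \<le> inner x x"
      unfolding inner_fseq_def by (intro member_le_sum) (auto simp: finite_coord)
    then show ?thesis by (simp add: power2_eq_square)
  qed simp
  then show ?thesis by (simp add: norm_eq_sqrt_inner real_le_rsqrt)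
qed

lemma subspace_Rd: "subspace (Rd d)"
  by (auto simp: subspace_def Rd_def coord_simps)

lemma closed_Rd: "closed (Rd d)"
proof -
  have "bounded_linear (\<lambda>x. coord x i)" for i
    by (rule bounded_linear_intro[where K = 1])
      (simp_all add: coord_simps abs_coord_le_norm)
  then have "continuous_on UNIV (\<lambda>x. coord x i)" for i
    by (rule linear_continuous_on)
  then have "closed {x. coord x i = 0}" for i
    by (intro closed_Collect_eq) (auto intro: continuous_intros)
  moreover have "Rd d = (\<Inter>i\<in>{d..}. {x. coord x i = 0})"
    by (auto simp: Rd_def)
  ultimately show ?thesis by auto
qed

text \<open>
  The body is that of \<^const>\<open>closest_point\<close>, which the class constraint \<^class>\<open>heine_borel\<close>
  makes unavailable here. Existence of the closest point holds for nonempty closed subsets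
  of some \<open>Rd d\<close>.
\<close>

definition proj :: "fseq set \<Rightarrow> fseq \<Rightarrow> fseq" where
  "proj S a = (SOME x. x \<in> S \<and> (\<forall>y\<in>S. dist a x \<le> dist a y))"

text \<open>
  Objectives are functions on the whole type, but only their values on \<open>Rd d\<close> are ever used.
\<close>

definition subdifferential :: "nat \<Rightarrow> (fseq \<Rightarrow> real) \<Rightarrow> fseq \<Rightarrow> fseq set" where
  "subdifferential d f x = {g \<in> Rd d. \<forall>y\<in>Rd d. f y \<ge> f x + inner g (y - x)}"

definition minimizers :: "fseq set \<Rightarrow> (fseq \<Rightarrow> real) \<Rightarrow> fseq set" where
  "minimizers X f = {x. is_arg_min f (\<lambda>x. x \<in> X) x}"

text \<open>The infimum is attained whenever \<open>minimizers X f\<close> is nonempty.\<close>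

definition min_value :: "fseq set \<Rightarrow> (fseq \<Rightarrow> real) \<Rightarrow> real" where
  "min_value X f = (INF x\<in>X. f x)"

definition problem_instance :: "nat \<Rightarrow> fseq set \<Rightarrow> (fseq \<Rightarrow> real) \<Rightarrow> real \<Rightarrow> bool" where
  "problem_instance d X f L \<longleftrightarrow>
     X \<subseteq> Rd d \<and> X \<noteq> {} \<and> closed X \<and> convex X \<and>
     convex_on (Rd d) f \<and> L-lipschitz_on (Rd d) f \<and> minimizers X f \<noteq> {}"

text \<open>
  Only the entries \<open>x 1, \<dots>, x n\<close> of the sequence are constrained.
\<close>

definition trajectory ::
    "nat \<Rightarrow> fseq set \<Rightarrow> (fseq \<Rightarrow> real) \<Rightarrow> real \<Rightarrow> nat \<Rightarrow> (nat \<Rightarrow> fseq) \<Rightarrow> bool" where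
  "trajectory d X f \<eta> n x \<longleftrightarrow>
     x 1 \<in> X \<and>
     (\<forall>k. 1 \<le> k \<and> k < n \<longrightarrow>
        (\<exists>g\<in>subdifferential d f (x k). x (Suc k) = proj X (x k - \<eta> *\<^sub>R g)))"

text \<open>The supremum is taken in \<^typ>\<open>ereal\<close>, so its finiteness is not presupposed.\<close>

definition Gamma_sup :: "nat \<Rightarrow> nat \<Rightarrow> ereal" where
  "Gamma_sup d n =
     Sup {ereal ((f (x n) - min_value X f) / (\<eta> * L\<^sup>2)) | \<eta> L X f x.
            \<eta> > 0 \<and> L > 0 \<and> problem_instance d X f L \<and>
            x 1 \<in> minimizers X f \<and> trajectory d X f \<eta> n x}"

definition anytime_const :: "nat \<Rightarrow> real \<Rightarrow> bool" where
  "anytime_const d A \<longleftrightarrow> A \<ge> 0 \<and>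
     (\<forall>n\<ge>1. \<forall>X f L \<eta> x.
        problem_instance d X f L \<and> \<eta> > 0 \<and> trajectory d X f \<eta> n x \<longrightarrow>
        f (x n) - min_value X f
          \<le> A * \<eta> * L\<^sup>2 + (infdist (x 1) (minimizers X f))\<^sup>2 / (2 * real n * \<eta>))"

definition A_star :: "nat \<Rightarrow> real" where
  "A_star d = (LEAST A. anytime_const d A)"

end

theory Submission
  imports Defs
begin

text \<open>
  Everything on the upper side comes from the distance inequality of a projected subgradient step,
  \<open>\<bar>x\<^bsub>k+1\<^esub> - z\<bar>\<^sup>2 \<le> \<bar>x\<^bsub>k\<^esub> - z\<bar>\<^sup>2 - 2 \<eta> (f x\<^bsub>k\<^esub> - f z) + \<eta>\<^sup>2 L\<^sup>2\<close>, valid for every feasible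
  \<open>z\<close>. Put \<open>u = \<eta> L\<^sup>2\<close>.

  Dimension bound. For \<open>r = 0, 1, 2, \<dots>\<close> let \<open>b r\<close> be the last time at which the objective is below
  \<open>f x\<^bsub>n\<^esub> - r u\<close>. The inequality, summed from \<open>b l\<close> to the end and used with \<open>z = x\<^bsub>b k\<^esub>\<close> and with
  \<open>z = x\<^bsub>b l\<^esub>\<close>, forces the vectors from \<open>x\<^bsub>b k\<^esub>\<close> and \<open>x\<^bsub>b l\<^esub>\<close> to the end point to form an obtuse
  angle, because over that stretch the objective is on average more than \<open>u / 2\<close> above the mean of
  the two values. Since
  \<open>\<real>\<^sup>d\<close> has room for only \<open>d + 1\<close> vectors with pairwise negative inner products, the last value exceeds the
  smallest value along the trajectory by at most \<open>(d + 1) u\<close> (\<open>excursion_le_dimension\<close>). The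
  smallest value is below the average, which the classical argument bounds by
  \<open>f\<^sub>\<star> + u / 2 + dist\<^sup>2 / (2 n \<eta>)\<close>; and \<open>d + 3 / 2 \<le> 2 d + 1 / 2\<close>.

  Logarithmic bound. Instead of a fixed \<open>z\<close> one uses reference points that drift from \<open>x\<^sub>1\<close> towards
  the current iterate, with weights chosen so that all intermediate objective values cancel
  (\<open>excursion_le_log\<close>).

  Lower bounds. An instance is described by a finite set \<open>G\<close> of subgradients, the objective being
  the maximum of the linear functions they define. Two more dimensions \<open>p\<close>, \<open>q\<close> raise the excursion
  by almost \<open>1 / 4\<close> (\<open>excursion_system_extend\<close>): oscillating between two steep walls in direction
  \<open>q\<close> lets the iterate climb along \<open>p\<close>, on which the rest of the objective depends so weakly that
  the gain of \<open>1 / 4\<close> hardly decays while the old trajectory is run afterwards. The horizon is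
  multiplied by a constant each time, so an excursion of order \<open>m\<close> takes \<open>2 m + 1\<close> dimensions and a
  horizon exponential in \<open>m\<close>.
\<close>

section \<open>Compactness and projections in coordinate subspaces\<close>

definition unit_vec :: "nat \<Rightarrow> fseq" where
  "unit_vec i = Abs_fseq (\<lambda>j. if j = i then 1 else 0)"

lemma coord_unit_vec: "coord (unit_vec i) j = (if j = i then 1 else 0)"
  unfolding unit_vec_def by (subst coord_Abs) auto

lemma inner_unit_vec_left: "inner (unit_vec i) y = coord y i"
proof -
  have "inner (unit_vec i) y = (\<Sum>j\<in>{i}. coord (unit_vec i) j * coord y j)"
    by (rule inner_fseq_superset) (auto simp: coord_unit_vec)
  then show ?thesis by (simp add: coord_unit_vec)
qed

lemma inner_unit_vec_right: "inner y (unit_vec i) = coord y i"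
  by (simp add: inner_commute[of y] inner_unit_vec_left)

lemma unit_vec_in_Rd: "i < d \<Longrightarrow> unit_vec i \<in> Rd d"
  by (auto simp: Rd_def coord_unit_vec)

lemma Rd_mono: "d \<le> d' \<Longrightarrow> Rd d \<subseteq> Rd d'"
  by (auto simp: Rd_def)

lemma zero_in_Rd: "0 \<in> Rd d"
  by (simp add: Rd_def coord_zero)

lemma add_in_Rd: "x \<in> Rd d \<Longrightarrow> y \<in> Rd d \<Longrightarrow> x + y \<in> Rd d"
  by (simp add: Rd_def coord_plus)

lemma diff_in_Rd: "x \<in> Rd d \<Longrightarrow> y \<in> Rd d \<Longrightarrow> x - y \<in> Rd d"
  by (simp add: Rd_def coord_minus)

lemma Rd_Suc_decompose:
  assumes "x \<in> Rd (Suc d)"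
  obtains y where "y \<in> Rd d" "x = y + coord x d *\<^sub>R unit_vec d" "norm y \<le> norm x"
proof -
  define y where "y = x - coord x d *\<^sub>R unit_vec d"
  have x: "x = y + coord x d *\<^sub>R unit_vec d" by (simp add: y_def)
  have y: "y \<in> Rd d"
    using assms by (auto simp: y_def Rd_def coord_simps coord_unit_vec not_less_eq_eq)
  have "inner y (unit_vec d) = 0"
    using y by (simp add: inner_unit_vec_right Rd_def)
  then have "orthogonal y (coord x d *\<^sub>R unit_vec d)"
    by (simp add: orthogonal_def)
  then have "(norm x)\<^sup>2 = (norm y)\<^sup>2 + (norm (coord x d *\<^sub>R unit_vec d))\<^sup>2"
    using x norm_add_Pythagorean by metis
  then have "(norm y)\<^sup>2 \<le> (norm x)\<^sup>2" by simp
  then have "norm y \<le> norm x" by (rule power2_le_imp_le) simp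
  with x y show ?thesis using that by blast
qed

lemma compact_Rd_cball: "compact (Rd d \<inter> cball 0 r)"
proof (induction d)
  case 0
  have "Rd 0 = {0}"
    by (auto simp: Rd_def coord_zero intro: fseq_eqI)
  then show ?case by (simp add: finite_imp_compact)
next
  case (Suc d)
  let ?h = "\<lambda>(y, t). y + t *\<^sub>R unit_vec d"
  have "compact (?h ` ((Rd d \<inter> cball 0 r) \<times> {-r..r}))"
    by (intro compact_continuous_image compact_Times Suc.IH)
       (auto simp: case_prod_unfold intro!: continuous_intros)
  moreover have "Rd (Suc d) \<inter> cball 0 r \<subseteq> ?h ` ((Rd d \<inter> cball 0 r) \<times> {-r..r})"
  proof
    fix x assume x: "x \<in> Rd (Suc d) \<inter> cball 0 r"
    then obtain y where "y \<in> Rd d" "x = y + coord x d *\<^sub>R unit_vec d" "norm y \<le> norm x"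
      using Rd_Suc_decompose by blast
    moreover have "\<bar>coord x d\<bar> \<le> r"
      using abs_coord_le_norm[of x d] x by simp
    ultimately show "x \<in> ?h ` ((Rd d \<inter> cball 0 r) \<times> {-r..r})"
      using x by (intro image_eqI[of _ _ "(y, coord x d)"]) (auto simp: abs_le_iff)
  qed
  moreover have "closed (Rd (Suc d) \<inter> cball 0 r)"
    by (intro closed_Int closed_Rd closed_cball)
  ultimately show ?case
    by (metis compact_Int_closed inf.absorb_iff2)
qed

text \<open>
  Outside a large ball the quadratic term beats the at most linear decrease of a Lipschitz
  function, so the minimization takes place on a compact set.
\<close>

lemma proximal_point_exists:
  assumes X: "X \<subseteq> Rd d" "closed X" "X \<noteq> {}"
    and f: "L-lipschitz_on X f" and c: "c \<ge> 0"
  obtains y where "y \<in> X"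
    "\<And>z. z \<in> X \<Longrightarrow> c * f y + (norm (y - a))\<^sup>2 \<le> c * f z + (norm (z - a))\<^sup>2"
proof -
  obtain z0 where z0: "z0 \<in> X" using X by blast
  have L: "L \<ge> 0" using f by (rule lipschitz_on_nonneg)
  define e0 where "e0 = norm (z0 - a)"
  define r where "r = e0 + c * L"
  have r: "e0 \<le> r" using c L by (simp add: r_def)
  let ?\<phi> = "\<lambda>y. c * f y + (norm (y - a))\<^sup>2"
  have "X \<inter> cball a r = (Rd d \<inter> cball 0 (norm a + r)) \<inter> (X \<inter> cball a r)"
    using X(1) norm_triangle_sub[of _ a]
    by (auto simp: dist_norm norm_minus_commute) (smt (verit) norm_triangle_sub)
  then have "compact (X \<inter> cball a r)"
    by (metis X(2) closed_Int closed_cball compact_Int_closed compact_Rd_cball)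
  moreover have "z0 \<in> X \<inter> cball a r"
    using z0 r by (simp add: e0_def dist_norm norm_minus_commute)
  moreover have "continuous_on (X \<inter> cball a r) ?\<phi>"
    by (intro continuous_intros continuous_on_subset[OF lipschitz_on_continuous_on[OF f]]) auto
  ultimately obtain y where y: "y \<in> X \<inter> cball a r" "\<And>z. z \<in> X \<inter> cball a r \<Longrightarrow> ?\<phi> y \<le> ?\<phi> z"
    using continuous_attains_inf[of "X \<inter> cball a r" ?\<phi>] by blast
  have "?\<phi> y \<le> ?\<phi> z" if z: "z \<in> X" for z
  proof (cases "norm (z - a) \<le> r")
    case True
    then show ?thesis using y(2)[of z] z by (simp add: dist_norm norm_minus_commute[of a z])
  next
    case False
    define e where "e = norm (z - a)"
    have "norm (z0 - z) \<le> e + e0"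
      unfolding e_def e0_def by (metis add.commute norm_diff_triangle_le norm_minus_commute order_refl)
    then have "L * norm (z0 - z) \<le> L * (e + e0)" using L by (rule mult_left_mono)
    moreover have "f z0 - f z \<le> L * norm (z0 - z)"
      using lipschitz_onD[OF f z0 z] by (simp add: dist_norm)
    ultimately have "f z0 - f z \<le> L * (e + e0)" by simp
    then have "c * (f z0 - f z) \<le> c * (L * (e + e0))" using c by (rule mult_left_mono)
    moreover have "0 \<le> (e + e0) * (e - e0 - c * L)"
      using False by (intro mult_nonneg_nonneg) (auto simp: e_def e0_def r_def)
    ultimately have "?\<phi> z0 \<le> ?\<phi> z"
      by (simp add: e_def[symmetric] e0_def[symmetric] algebra_simps power2_eq_square)
    with y(2)[OF \<open>z0 \<in> X \<inter> cball a r\<close>] show ?thesis by simp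
  qed
  with y(1) show ?thesis using that by blast
qed

lemma norm_convex_combination:
  fixes u v :: "'a::real_inner"
  shows "(norm ((1 - t) *\<^sub>R u + t *\<^sub>R v))\<^sup>2
    = (1 - t) * (norm u)\<^sup>2 + t * (norm v)\<^sup>2 - t * (1 - t) * (norm (u - v))\<^sup>2"
  by (simp add: power2_norm_eq_inner inner_simps inner_commute algebra_simps)

text \<open>
  The objective is strongly convex, so it grows at least quadratically away from its minimizer;
  the growth is read off by comparing the minimizer with points of the segment towards \<open>z\<close>.
\<close>

lemma proximal_three_point:
  fixes y :: "'a::real_inner"
  assumes f: "convex_on X f" and c: "c \<ge> 0" and y: "y \<in> X" and z: "z \<in> X"
    and min: "\<And>w. w \<in> X \<Longrightarrow> c * f y + (norm (y - a))\<^sup>2 \<le> c * f w + (norm (w - a))\<^sup>2"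
  shows "c * f y + (norm (y - a))\<^sup>2 + (norm (y - z))\<^sup>2 \<le> c * f z + (norm (z - a))\<^sup>2"
proof -
  let ?\<Delta> = "c * f z + (norm (z - a))\<^sup>2 - c * f y - (norm (y - a))\<^sup>2"
  have le: "(1 - t) * (norm (y - z))\<^sup>2 \<le> ?\<Delta>" if t: "0 < t" "t < 1" for t
  proof -
    define w where "w = (1 - t) *\<^sub>R y + t *\<^sub>R z"
    have "w \<in> X"
      unfolding w_def using convex_on_imp_convex[OF f] y z t by (simp add: convex_alt)
    have "f w \<le> (1 - t) * f y + t * f z"
      unfolding w_def by (rule convex_onD[OF f]) (use y z t in auto)
    then have "c * f w \<le> c * ((1 - t) * f y + t * f z)" using c by (rule mult_left_mono)
    moreover have "w - a = (1 - t) *\<^sub>R (y - a) + t *\<^sub>R (z - a)"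
      by (simp add: w_def algebra_simps)
    then have "(norm (w - a))\<^sup>2
        = (1 - t) * (norm (y - a))\<^sup>2 + t * (norm (z - a))\<^sup>2 - t * (1 - t) * (norm ((y - a) - (z - a)))\<^sup>2"
      by (simp only: norm_convex_combination)
    moreover have "(y - a) - (z - a) = y - z" by simp
    ultimately have "t * ((1 - t) * (norm (y - z))\<^sup>2) \<le> t * ?\<Delta>"
      using min[OF \<open>w \<in> X\<close>] by (simp add: algebra_simps)
    then show ?thesis using t by simp
  qed
  have "((\<lambda>t. (1 - t) * (norm (y - z))\<^sup>2) \<longlongrightarrow> (1 - 0) * (norm (y - z))\<^sup>2) (at_right 0)"
    by (intro tendsto_intros)
  moreover have "eventually (\<lambda>t. (1 - t) * (norm (y - z))\<^sup>2 \<le> ?\<Delta>) (at_right 0)"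
    by (rule eventually_mono[OF eventually_at_right_real[of 0 1]]) (use le in auto)
  ultimately have "(1 - 0) * (norm (y - z))\<^sup>2 \<le> ?\<Delta>"
    by (rule tendsto_upperbound) simp
  then show ?thesis by simp
qed

lemma proj_properties:
  assumes X: "X \<subseteq> Rd d" "closed X" "X \<noteq> {}" "convex X"
  shows proj_in: "proj X a \<in> X"
    and proj_le: "z \<in> X \<Longrightarrow> norm (proj X a - z) \<le> norm (a - z)"
proof -
  have lip: "0-lipschitz_on X (\<lambda>_. 0 :: real)" by (rule lipschitz_onI) auto
  obtain y where y: "y \<in> X" "\<And>z. z \<in> X \<Longrightarrow> (norm (y - a))\<^sup>2 \<le> (norm (z - a))\<^sup>2"
    using proximal_point_exists[OF X(1-3) lip, of 0 a] by auto
  have "dist a y \<le> dist a z" if "z \<in> X" for z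
    unfolding dist_norm norm_minus_commute[of a]
    by (rule power2_le_imp_le[OF y(2)[OF that]]) simp
  with y(1) have "\<exists>x. x \<in> X \<and> (\<forall>y\<in>X. dist a x \<le> dist a y)" by blast
  from someI_ex[OF this]
  have p: "proj X a \<in> X" "\<And>z. z \<in> X \<Longrightarrow> dist a (proj X a) \<le> dist a z"
    by (auto simp: proj_def)
  then show "proj X a \<in> X" by simp
  assume z: "z \<in> X"
  have "(norm (proj X a - a))\<^sup>2 + (norm (proj X a - z))\<^sup>2 \<le> (norm (z - a))\<^sup>2"
    using proximal_three_point[of X "\<lambda>_. 0" 0 "proj X a" z a] p z X(4)
    by (simp add: convex_on_def dist_norm norm_minus_commute[of a])
  then have "(norm (proj X a - z))\<^sup>2 \<le> (norm (a - z))\<^sup>2"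
    unfolding norm_minus_commute[of a z]
    using zero_le_power2[of "norm (proj X a - a)"] by linarith
  then show "norm (proj X a - z) \<le> norm (a - z)" by (rule power2_le_imp_le) simp
qed

section \<open>The distance inequality of a subgradient step\<close>

lemma min_value_eq:
  assumes "z \<in> minimizers X f"
  shows "min_value X f = f z"
  unfolding min_value_def
  by (rule cInf_eq_minimum) (use assms in \<open>auto simp: minimizers_def is_arg_min_linorder\<close>)

lemma minimizersD: "z \<in> minimizers X f \<Longrightarrow> z \<in> X" "z \<in> minimizers X f \<Longrightarrow> y \<in> X \<Longrightarrow> f z \<le> f y"
  by (auto simp: minimizers_def is_arg_min_linorder)

lemma subgradient_norm_le:
  assumes f: "L-lipschitz_on (Rd d) f" and x: "x \<in> Rd d" and g: "g \<in> subdifferential d f x"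
  shows "norm g \<le> L"
proof (cases "g = 0")
  case True
  then show ?thesis using lipschitz_on_nonneg[OF f] by simp
next
  case False
  have g': "g \<in> Rd d" "x + g \<in> Rd d"
    using g x by (auto simp: subdifferential_def add_in_Rd)
  have "f (x + g) \<ge> f x + inner g (x + g - x)"
    using g g'(2) unfolding subdifferential_def by blast
  moreover have "f (x + g) - f x \<le> L * norm g"
    using lipschitz_onD[OF f g'(2) x] by (simp add: dist_norm)
  ultimately have "norm g * norm g \<le> L * norm g"
    by (simp add: power2_norm_eq_inner[symmetric] power2_eq_square)
  then show ?thesis using False by simp
qed

lemma subgradient_step:
  assumes inst: "problem_instance d X f L" and \<eta>: "\<eta> > 0"
    and x: "x \<in> X" and z: "z \<in> X" and g: "g \<in> subdifferential d f x"
  shows "(norm (proj X (x - \<eta> *\<^sub>R g) - z))\<^sup>2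
    \<le> (norm (x - z))\<^sup>2 - 2 * \<eta> * (f x - f z) + \<eta>\<^sup>2 * L\<^sup>2"
proof -
  have X: "X \<subseteq> Rd d" "closed X" "X \<noteq> {}" "convex X" and f: "L-lipschitz_on (Rd d) f"
    using inst by (auto simp: problem_instance_def)
  have "norm g \<le> L" using subgradient_norm_le[OF f _ g] x X by blast
  then have g2: "\<eta>\<^sup>2 * (norm g)\<^sup>2 \<le> \<eta>\<^sup>2 * L\<^sup>2" by (intro mult_left_mono power_mono) auto
  have "f z \<ge> f x + inner g (z - x)"
    using g z X by (auto simp: subdifferential_def)
  then have "2 * \<eta> * (f x - f z) \<le> 2 * \<eta> * inner g (x - z)"
    using \<eta> by (intro mult_left_mono) (auto simp: inner_diff_right)
  moreover have "(norm (proj X (x - \<eta> *\<^sub>R g) - z))\<^sup>2 \<le> (norm (x - \<eta> *\<^sub>R g - z))\<^sup>2"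
    by (rule power_mono[OF proj_le[OF X z]]) simp
  moreover have "(norm (x - \<eta> *\<^sub>R g - z))\<^sup>2
      = (norm (x - z))\<^sup>2 - 2 * \<eta> * inner g (x - z) + \<eta>\<^sup>2 * (norm g)\<^sup>2"
    by (simp add: power2_norm_eq_inner inner_simps inner_commute algebra_simps)
       (simp add: power2_eq_square)
  ultimately show ?thesis using g2 by linarith
qed

lemma trajectory_in:
  assumes inst: "problem_instance d X f L" and tr: "trajectory d X f \<eta> n x"
    and k: "1 \<le> k" "k \<le> n"
  shows "x k \<in> X"
  using k
proof (induction k rule: dec_induct)
  case base
  then show ?case using tr by (simp add: trajectory_def)
next
  case (step k)
  then obtain g where "x (Suc k) = proj X (x k - \<eta> *\<^sub>R g)"
    using tr by (auto simp: trajectory_def)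
  then show ?case using proj_in[of X d] inst by (simp add: problem_instance_def)
qed

lemma trajectory_step:
  assumes inst: "problem_instance d X f L" and \<eta>: "\<eta> > 0" and tr: "trajectory d X f \<eta> n x"
    and k: "1 \<le> k" "k < n" and z: "z \<in> X"
  shows "(norm (x (Suc k) - z))\<^sup>2 \<le> (norm (x k - z))\<^sup>2 - 2 * \<eta> * (f (x k) - f z) + \<eta>\<^sup>2 * L\<^sup>2"
proof -
  obtain g where "g \<in> subdifferential d f (x k)" "x (Suc k) = proj X (x k - \<eta> *\<^sub>R g)"
    using tr k by (auto simp: trajectory_def)
  then show ?thesis
    using subgradient_step[OF inst \<eta> trajectory_in[OF inst tr] z] k by simp
qed

text \<open>
  The last iterate carries no subgradient. A proximal step continues the trajectory by one point
  with the same inequality, because the proximal point at distance \<open>e\<close> has lost at most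
  \<open>L * e\<close> in value and \<open>2 * \<eta> * L * e - e\<^sup>2 \<le> \<eta>\<^sup>2 * L\<^sup>2\<close>.
\<close>

lemma extra_step:
  assumes inst: "problem_instance d X f L" and \<eta>: "\<eta> > 0" and a: "a \<in> X"
  obtains w where "w \<in> X"
    "\<And>z. z \<in> X \<Longrightarrow> (norm (w - z))\<^sup>2 \<le> (norm (a - z))\<^sup>2 - 2 * \<eta> * (f a - f z) + \<eta>\<^sup>2 * L\<^sup>2"
proof -
  have X: "X \<subseteq> Rd d" "closed X" "X \<noteq> {}" "convex X"
    and fRd: "L-lipschitz_on (Rd d) f" "convex_on (Rd d) f"
    using inst by (auto simp: problem_instance_def)
  have f: "L-lipschitz_on X f" "convex_on X f"
    using lipschitz_on_subset[OF fRd(1) X(1)] convex_on_subset[OF fRd(2) X(1)] X(4) by auto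
  obtain w where w: "w \<in> X"
    "\<And>z. z \<in> X \<Longrightarrow> 2 * \<eta> * f w + (norm (w - a))\<^sup>2 \<le> 2 * \<eta> * f z + (norm (z - a))\<^sup>2"
    using proximal_point_exists[OF X(1-3) f(1), of "2 * \<eta>" a] \<eta> by auto
  have "(norm (w - z))\<^sup>2 \<le> (norm (a - z))\<^sup>2 - 2 * \<eta> * (f a - f z) + \<eta>\<^sup>2 * L\<^sup>2" if z: "z \<in> X" for z
  proof -
    have "2 * \<eta> * f w + (norm (w - a))\<^sup>2 + (norm (w - z))\<^sup>2 \<le> 2 * \<eta> * f z + (norm (z - a))\<^sup>2"
      by (rule proximal_three_point[OF f(2) _ w(1) z w(2)]) (use \<eta> in auto)
    moreover have "f a - f w \<le> L * norm (w - a)"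
      using lipschitz_onD[OF f(1) a w(1)] by (simp add: dist_norm norm_minus_commute)
    then have "2 * \<eta> * (f a - f w) \<le> 2 * \<eta> * (L * norm (w - a))"
      using \<eta> by (intro mult_left_mono) auto
    moreover have "0 \<le> (\<eta> * L - norm (w - a))\<^sup>2" by simp
    ultimately show ?thesis
      by (simp add: power2_diff power_mult_distrib norm_minus_commute algebra_simps)
  qed
  with w(1) show ?thesis using that by blast
qed

text \<open>
  The form in which the distance inequality is used below: summed over the steps from time \<open>b\<close>
  to the end, for the trajectory continued by one point.
\<close>

lemma summed_steps:
  assumes inst: "problem_instance d X f L" and \<eta>: "\<eta> > 0" and tr: "trajectory d X f \<eta> n x"
    and n: "n \<ge> 1"
  obtains w where "w \<in> X"
    "\<And>b z. 1 \<le> b \<Longrightarrow> b \<le> n \<Longrightarrow> z \<in> X \<Longrightarrow>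
       \<eta> * (\<Sum>j=b..n. 2 * (f (x j) - f z) - \<eta> * L\<^sup>2) \<le> (norm (x b - z))\<^sup>2 - (norm (w - z))\<^sup>2"
proof -
  obtain w where w: "w \<in> X"
    "\<And>z. z \<in> X \<Longrightarrow> (norm (w - z))\<^sup>2 \<le> (norm (x n - z))\<^sup>2 - 2 * \<eta> * (f (x n) - f z) + \<eta>\<^sup>2 * L\<^sup>2"
    using extra_step[OF inst \<eta> trajectory_in[OF inst tr n order_refl]] by blast
  have "\<eta> * (\<Sum>j=b..n. 2 * (f (x j) - f z) - \<eta> * L\<^sup>2) \<le> (norm (x b - z))\<^sup>2 - (norm (w - z))\<^sup>2"
    if b: "1 \<le> b" "b \<le> n" and z: "z \<in> X" for b z
    using b(2,1)
  proof (induction b rule: inc_induct)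
    case base
    then show ?case using w(2)[OF z] by (simp add: algebra_simps power2_eq_square)
  next
    case (step b)
    have "(\<Sum>j=b..n. 2 * (f (x j) - f z) - \<eta> * L\<^sup>2)
        = (2 * (f (x b) - f z) - \<eta> * L\<^sup>2) + (\<Sum>j=Suc b..n. 2 * (f (x j) - f z) - \<eta> * L\<^sup>2)"
      using step.hyps by (intro sum.atLeast_Suc_atMost) simp
    then show ?case
      using step trajectory_step[OF inst \<eta> tr step.prems step.hyps(2) z]
      by (simp add: distrib_left) (simp add: algebra_simps power2_eq_square)
  qed
  with w(1) show ?thesis using that by blast
qed

section \<open>Vectors with pairwise negative inner products\<close>

lemma Rd_subset_span: "Rd d \<subseteq> span (unit_vec ` {..<d})"
proof (induction d)
  case 0
  have "x = 0" if "x \<in> Rd 0" for x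
    by (rule fseq_eqI) (use that in \<open>simp add: Rd_def coord_zero\<close>)
  then show ?case by auto
next
  case (Suc d)
  show ?case
  proof
    fix x assume "x \<in> Rd (Suc d)"
    then obtain y where y: "y \<in> Rd d" "x = y + coord x d *\<^sub>R unit_vec d"
      using Rd_Suc_decompose by blast
    have "span (unit_vec ` {..<d}) \<subseteq> span (unit_vec ` {..<Suc d})"
      by (intro span_mono image_mono) auto
    then have "y \<in> span (unit_vec ` {..<Suc d})"
      using y(1) Suc.IH by blast
    moreover have "unit_vec d \<in> span (unit_vec ` {..<Suc d})"
      by (intro span_base) auto
    ultimately show "x \<in> span (unit_vec ` {..<Suc d})"
      by (subst y(2)) (intro span_add span_scale)
  qed
qed

lemma independent_card_le:
  assumes "independent V" "V \<subseteq> Rd d"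
  shows "card V \<le> d"
proof -
  have "card V \<le> card (unit_vec ` {..<d})"
    using independent_span_bound[of "unit_vec ` {..<d}" V] assms Rd_subset_span[of d] by auto
  also have "\<dots> \<le> d" using card_image_le[of "{..<d}" unit_vec] by simp
  finally show ?thesis .
qed

text \<open>
  Set one vector \<open>v\<close> aside. If the others were dependent, sorting a relation by the sign of its
  coefficients would give a vector that equals two positive combinations with nonpositive inner
  product, hence is \<open>0\<close>; but its inner product with \<open>v\<close> is negative.
\<close>

lemma card_pairwise_obtuse_le:
  assumes fin: "finite V" and V: "V \<subseteq> Rd d"
    and neg: "\<And>u v. u \<in> V \<Longrightarrow> v \<in> V \<Longrightarrow> u \<noteq> v \<Longrightarrow> inner u v < 0"
  shows "card V \<le> d + 1"
proof (cases "V = {}")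
  case False
  then obtain v where v: "v \<in> V" by blast
  define W where "W = V - {v}"
  have finW: "finite W" using fin by (simp add: W_def)
  have no_pos: False
    if c: "(\<Sum>u\<in>W. c u *\<^sub>R u) = 0" and u0: "u0 \<in> W" "c u0 > 0" for c u0
  proof -
    define A where "A = {u\<in>W. c u > 0}"
    define B where "B = W - A"
    define P where "P = (\<Sum>u\<in>A. c u *\<^sub>R u)"
    have AB: "A \<subseteq> W" "finite A" "finite B" using finW by (auto simp: A_def B_def)
    have "(\<Sum>u\<in>W. c u *\<^sub>R u) = (\<Sum>u\<in>B. c u *\<^sub>R u) + P"
      unfolding P_def B_def by (rule sum.subset_diff[OF AB(1) finW])
    then have "(\<Sum>u\<in>B. c u *\<^sub>R u) = - P" using c by (simp add: eq_neg_iff_add_eq_0)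
    then have P2: "P = (\<Sum>u\<in>B. (- c u) *\<^sub>R u)" by (simp add: sum_negf)
    have "inner P P = (\<Sum>u\<in>A. \<Sum>u'\<in>B. (c u * (- c u')) * inner u u')"
      by (subst (2) P2)
         (simp add: P_def inner_sum_left inner_sum_right sum_distrib_left mult_ac sum_negf
           sum.swap[of _ A B])
    also have "\<dots> \<le> 0"
    proof (intro sum_nonpos)
      fix u u' assume uu: "u \<in> A" "u' \<in> B"
      then have "inner u u' < 0" by (intro neg) (auto simp: A_def B_def W_def)
      moreover have "c u * (- c u') \<ge> 0"
        using uu by (intro mult_nonneg_nonneg) (auto simp: A_def B_def)
      ultimately show "(c u * (- c u')) * inner u u' \<le> 0"
        by (intro mult_nonneg_nonpos) auto
    qed
    finally have "P = 0" using inner_gt_zero_iff[of P] by linarith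
    then have "(\<Sum>u\<in>A. c u * inner u v) = 0"
      by (metis (no_types, lifting) P_def inner_scaleR_left inner_sum_left inner_zero_left sum.cong)
    moreover have "(\<Sum>u\<in>A. c u * inner u v) < 0"
    proof -
      have "(\<Sum>u\<in>A. c u * inner u v) < (\<Sum>u\<in>A. 0)"
      proof (rule sum_strict_mono)
        show "finite A" "A \<noteq> {}" using AB u0 by (auto simp: A_def)
        fix u assume "u \<in> A"
        then show "c u * inner u v < 0"
          using neg[of u v] v by (intro mult_pos_neg) (auto simp: A_def W_def)
      qed
      then show ?thesis by simp
    qed
    ultimately show False by simp
  qed
  have "independent W"
  proof
    assume "dependent W"
    then obtain c u0 where c: "u0 \<in> W" "c u0 \<noteq> 0" "(\<Sum>u\<in>W. c u *\<^sub>R u) = 0"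
      using dependent_finite[OF finW] by auto
    then have "(\<Sum>u\<in>W. (- c u) *\<^sub>R u) = 0" by (simp add: sum_negf)
    then show False
      using no_pos[of c u0] no_pos[of "\<lambda>u. - c u" u0] c by (cases "c u0 > 0") auto
  qed
  then have "card W \<le> d" by (rule independent_card_le) (use V in \<open>auto simp: W_def\<close>)
  then show ?thesis using v fin by (simp add: W_def)
qed simp

section \<open>The excursion is bounded by the dimension\<close>

text \<open>
  If the value dropped further below \<open>f (x n)\<close>, there would be \<open>d + 2\<close> levels, one unit
  \<open>\<eta> * L\<^sup>2\<close> apart, each with a last time \<open>b r\<close> below it, and the vectors \<open>U r\<close> from these iterates
  to the end point would have pairwise negative inner products. The end point is that of the
  continued trajectory, so that every stretch from \<open>b l\<close> contains at least the two steps at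
  \<open>b l\<close> and \<open>n\<close>.
\<close>

lemma excursion_le_dimension:
  assumes inst: "problem_instance d X f L" and \<eta>: "\<eta> > 0" and tr: "trajectory d X f \<eta> n x"
    and L: "L > 0" and i: "1 \<le> i" "i \<le> n"
  shows "f (x n) - f (x i) \<le> (real d + 1) * (\<eta> * L\<^sup>2)"
proof (rule ccontr)
  define u where "u = \<eta> * L\<^sup>2"
  have u: "u > 0" using \<eta> L by (simp add: u_def)
  define t where "t r = f (x n) - real r * u" for r
  define J where "J r = {j\<in>{1..n}. f (x j) < t r}" for r
  define b where "b r = Max (J r)" for r
  assume "\<not> ?thesis"
  then have fi: "f (x i) < f (x n) - real (d + 1) * u" by (simp add: u_def algebra_simps)
  have ti: "f (x i) < t r" if "r \<le> d + 1" for r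
  proof -
    have "real r * u \<le> real (d + 1) * u" using that u by (intro mult_right_mono) auto
    then show ?thesis using fi by (simp add: t_def)
  qed
  have J: "finite (J r)" "r \<le> d + 1 \<Longrightarrow> J r \<noteq> {}" for r
    using ti[of r] i by (auto simp: J_def)
  have b: "1 \<le> b r" "b r \<le> n" "f (x (b r)) < t r" if "r \<le> d + 1" for r
    using Max_in[OF J(1) J(2)[OF that]] unfolding b_def[symmetric] by (auto simp: J_def)
  have after_b: "t r \<le> f (x j)" if "b r < j" "j \<le> n" for r j
    using Max_ge[OF J(1), of j r] that unfolding b_def[symmetric] by (force simp: J_def)
  obtain w where w: "w \<in> X"
    and steps: "\<And>b z. 1 \<le> b \<Longrightarrow> b \<le> n \<Longrightarrow> z \<in> X \<Longrightarrow>
       \<eta> * (\<Sum>j=b..n. 2 * (f (x j) - f z) - \<eta> * L\<^sup>2) \<le> (norm (x b - z))\<^sup>2 - (norm (w - z))\<^sup>2"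
    using summed_steps[OF inst \<eta> tr] i by auto
  define U where "U r = w - x (b r)" for r
  have neg: "inner (U k) (U l) < 0" if kl: "l < k" "k \<le> d + 1" for k l
  proof -
    have lk: "l \<le> d + 1" using kl by simp
    have xX: "x (b k) \<in> X" "x (b l) \<in> X"
      using b kl lk by (auto intro!: trajectory_in[OF inst tr])
    \<comment> \<open>The excess of twice the objective over what an obtuse angle requires. It can be negative only
      at time \<open>b l\<close>, where the term at time \<open>n\<close> makes up for it.\<close>
    define h where "h j = 2 * f (x j) - f (x (b k)) - f (x (b l)) - u" for j
    have "real l * u + u \<le> real k * u"
      using mult_right_mono[of "real (Suc l)" "real k" u] kl u by (simp add: algebra_simps)
    then have fk: "f (x (b k)) < t l - u" using b(3)[OF kl(2)] by (simp add: t_def)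
    have fl: "f (x (b l)) < t l" using b(3)[OF lk] .
    have tl: "t l \<le> f (x n)" using u by (simp add: t_def)
    have bn: "b l < n"
      using b(2)[OF lk] fl tl by (cases "b l = n") auto
    have split: "{b l..n} = insert (b l) (insert n {b l<..<n})" using bn by auto
    have "(\<Sum>j=b l..n. h j) = (h (b l) + h n) + (\<Sum>j\<in>{b l<..<n}. h j)"
      unfolding split using bn by simp
    moreover have "h (b l) + h n > 0" using fk fl tl by (simp add: h_def)
    moreover have "(\<Sum>j\<in>{b l<..<n}. h j) \<ge> 0"
      using after_b[of l] fk fl by (intro sum_nonneg) (fastforce simp: h_def)
    ultimately have h: "(\<Sum>j=b l..n. h j) > 0" by linarith
    have "\<eta> * (\<Sum>j=b l..n. 2 * (f (x j) - f (x (b k))) - u)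
          + \<eta> * (\<Sum>j=b l..n. 2 * (f (x j) - f (x (b l))) - u)
        \<le> (norm (x (b l) - x (b k)))\<^sup>2 - (norm (U k))\<^sup>2 - (norm (U l))\<^sup>2"
      using steps[OF b(1,2)[OF lk] xX(1)] steps[OF b(1,2)[OF lk] xX(2)]
      by (simp add: u_def U_def)
    also have "x (b l) - x (b k) = U k - U l" by (simp add: U_def)
    also have "(norm (U k - U l))\<^sup>2 - (norm (U k))\<^sup>2 - (norm (U l))\<^sup>2 = - 2 * inner (U k) (U l)"
      by (simp add: power2_norm_eq_inner inner_simps inner_commute)
    also have "\<eta> * (\<Sum>j=b l..n. 2 * (f (x j) - f (x (b k))) - u)
          + \<eta> * (\<Sum>j=b l..n. 2 * (f (x j) - f (x (b l))) - u) = 2 * \<eta> * (\<Sum>j=b l..n. h j)"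
      by (simp add: distrib_left[symmetric] sum.distrib[symmetric] sum_distrib_left h_def)
         (simp add: algebra_simps)
    finally have "\<eta> * (\<Sum>j=b l..n. h j) \<le> - inner (U k) (U l)" by simp
    moreover have "\<eta> * (\<Sum>j=b l..n. h j) > 0" using \<eta> h by simp
    ultimately show ?thesis by simp
  qed
  have neg': "inner (U k) (U l) < 0" if "k \<noteq> l" "k \<le> d + 1" "l \<le> d + 1" for k l
    using neg[of k l] neg[of l k] that by (cases "k < l") (auto simp: inner_commute)
  have inj: "inj_on U {..d + 1}"
    by (rule inj_onI) (metis atMost_iff inner_ge_zero neg' not_less)
  have "X \<subseteq> Rd d" using inst by (simp add: problem_instance_def)
  then have "U ` {..d + 1} \<subseteq> Rd d"
    using w b trajectory_in[OF inst tr] by (auto simp: U_def intro!: diff_in_Rd)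
  then have "card (U ` {..d + 1}) \<le> d + 1"
  proof (intro card_pairwise_obtuse_le)
    fix y y' assume "y \<in> U ` {..d + 1}" "y' \<in> U ` {..d + 1}" "y \<noteq> y'"
    then obtain k l where "y = U k" "y' = U l" "k \<le> d + 1" "l \<le> d + 1" "k \<noteq> l" by auto
    then show "inner y y' < 0" using neg' by simp
  qed simp_all
  then show False using card_image[OF inj] by simp
qed

text \<open>
  The value of the best iterate is at most the average of all values, which the summed distance
  inequality bounds.
\<close>

lemma some_iterate_is_good:
  assumes inst: "problem_instance d X f L" and \<eta>: "\<eta> > 0" and tr: "trajectory d X f \<eta> n x"
    and n: "n \<ge> 1" and z: "z \<in> X"
  obtains i where "1 \<le> i" "i \<le> n"
    "f (x i) - f z \<le> \<eta> * L\<^sup>2 / 2 + (norm (x 1 - z))\<^sup>2 / (2 * real n * \<eta>)"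
proof (rule ccontr)
  let ?D = "(norm (x 1 - z))\<^sup>2"
  note good = that
  assume none: "\<not> thesis"
  have big: "?D / (real n * \<eta>) < 2 * (f (x i) - f z) - \<eta> * L\<^sup>2" if i: "i \<in> {1..n}" for i
  proof -
    have "\<eta> * L\<^sup>2 / 2 + ?D / (2 * real n * \<eta>) < f (x i) - f z"
      using none good[of i] i by force
    then show ?thesis by (simp add: field_simps)
  qed
  obtain w where "\<eta> * (\<Sum>j=1..n. 2 * (f (x j) - f z) - \<eta> * L\<^sup>2) \<le> ?D - (norm (w - z))\<^sup>2"
    using summed_steps[OF inst \<eta> tr n] n z by (metis order_refl)
  also have "\<dots> \<le> ?D" by simp
  finally have "\<eta> * (\<Sum>j=1..n. 2 * (f (x j) - f z) - \<eta> * L\<^sup>2) \<le> ?D" .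
  moreover have "(\<Sum>j=1..n. ?D / (real n * \<eta>)) < (\<Sum>j=1..n. 2 * (f (x j) - f z) - \<eta> * L\<^sup>2)"
    by (rule sum_strict_mono) (use n big in auto)
  then have "\<eta> * (\<Sum>j=1..n. ?D / (real n * \<eta>)) < \<eta> * (\<Sum>j=1..n. 2 * (f (x j) - f z) - \<eta> * L\<^sup>2)"
    using \<eta> by (rule mult_strict_left_mono)
  ultimately show False using \<eta> n by simp
qed

lemma le_infdist_square:
  assumes "A \<noteq> {}" "\<And>z. z \<in> A \<Longrightarrow> c \<le> (dist a z)\<^sup>2"
  shows "c \<le> (infdist a A)\<^sup>2"
proof (cases "c \<ge> 0")
  case True
  have "sqrt c \<le> infdist a A"
    unfolding infdist_notempty[OF assms(1)]
    by (rule cINF_greatest[OF assms(1)]) (simp add: assms(2) real_le_lsqrt)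
  then have "(sqrt c)\<^sup>2 \<le> (infdist a A)\<^sup>2" using True by (intro power_mono) auto
  then show ?thesis using True by simp
next
  case False
  then show ?thesis using zero_le_power2[of "infdist a A"] by linarith
qed

lemma anytime_constD:
  assumes "anytime_const d A" "problem_instance d X f L" "\<eta> > 0" "trajectory d X f \<eta> n x" "n \<ge> 1"
  shows "f (x n) - min_value X f
    \<le> A * \<eta> * L\<^sup>2 + (infdist (x 1) (minimizers X f))\<^sup>2 / (2 * real n * \<eta>)"
  using assms unfolding anytime_const_def by blast

lemma anytime_const_dimension:
  assumes d: "d \<ge> 1"
  shows "anytime_const d (2 * real d + 1 / 2)"
  unfolding anytime_const_def
proof (intro conjI allI impI, goal_cases)
  case (2 n X f L \<eta> x)
  then have inst: "problem_instance d X f L" and \<eta>: "\<eta> > 0" and tr: "trajectory d X f \<eta> n x"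
    and n: "n \<ge> 1" by auto
  let ?u = "\<eta> * L\<^sup>2"
  have L0: "L \<ge> 0" and ne: "minimizers X f \<noteq> {}" and lip: "L-lipschitz_on (Rd d) f"
    and X: "X \<subseteq> Rd d"
    using inst by (auto simp: problem_instance_def dest: lipschitz_on_nonneg)
  have le: "f (x n) - f z \<le> (real d + 3 / 2) * ?u + (norm (x 1 - z))\<^sup>2 / (2 * real n * \<eta>)"
    if "z \<in> minimizers X f" for z
  proof -
    have z: "z \<in> X" using that by (rule minimizersD)
    obtain i where i: "1 \<le> i" "i \<le> n"
      "f (x i) - f z \<le> ?u / 2 + (norm (x 1 - z))\<^sup>2 / (2 * real n * \<eta>)"
      using some_iterate_is_good[OF inst \<eta> tr n z] by blast
    have "f (x n) - f (x i) \<le> (real d + 1) * ?u"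
    proof (cases "L = 0")
      case True
      have "x n \<in> Rd d" "x i \<in> Rd d" using trajectory_in[OF inst tr] i n X by auto
      from lipschitz_onD[OF lip this] show ?thesis using True by (simp add: dist_real_def)
    next
      case False
      then show ?thesis using excursion_le_dimension[OF inst \<eta> tr _ i(1,2)] L0 by simp
    qed
    with i(3) show ?thesis by (simp add: algebra_simps)
  qed
  define c where "c = f (x n) - min_value X f - (2 * real d + 1 / 2) * ?u"
  have "(real d + 3 / 2) * ?u \<le> (2 * real d + 1 / 2) * ?u"
    using d \<eta> by (intro mult_right_mono) auto
  then have "c \<le> (norm (x 1 - z))\<^sup>2 / (2 * real n * \<eta>)" if "z \<in> minimizers X f" for z
    using le[OF that] by (simp add: c_def min_value_eq[OF that])
  then have "c * (2 * real n * \<eta>) \<le> (infdist (x 1) (minimizers X f))\<^sup>2"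
    using n \<eta> by (intro le_infdist_square[OF ne]) (simp add: field_simps dist_norm)
  then have "c \<le> (infdist (x 1) (minimizers X f))\<^sup>2 / (2 * real n * \<eta>)"
    using n \<eta> by (simp add: field_simps)
  then show ?case by (simp add: c_def algebra_simps)
qed simp

section \<open>The excursion is bounded by the logarithm of the horizon\<close>

text \<open>
  The weights of the reference points, counted backwards from the end, are \<open>1\<close> and then
  \<open>1 / weight_sum s\<close>; \<open>weight_sum\<close> is the sequence of their partial sums. Each weight being the
  reciprocal of the sum of the later ones is exactly what makes the coefficients of all intermediate
  objective values vanish. The recursion is a discretization of \<open>V' = 1 / V\<close>, so
  \<open>weight_sum s\<close> grows like \<open>sqrt (2 * s)\<close>, and the squared weights sum to half a logarithm.
\<close>

primrec weight_sum :: "nat \<Rightarrow> real" where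
  "weight_sum 0 = 1"
| "weight_sum (Suc s) = weight_sum s + 1 / weight_sum s"

declare weight_sum.simps(2) [simp del]

lemma weight_sum_ge_1: "weight_sum s \<ge> 1"
  by (induction s) (auto simp: weight_sum.simps(2) intro: add_increasing2)

lemma weight_sum_pos: "weight_sum s > 0"
  using weight_sum_ge_1[of s] by linarith

lemma weight_sum_square_ge: "(weight_sum (Suc s))\<^sup>2 \<ge> 2 * real s + 4"
proof (induction s)
  case (Suc s)
  have "(weight_sum (Suc (Suc s)))\<^sup>2 \<ge> (weight_sum (Suc s))\<^sup>2 + 2"
    using weight_sum_pos[of "Suc s"]
    by (simp add: weight_sum.simps(2)[of "Suc s"] power2_sum)
  with Suc show ?case by simp
qed (simp add: weight_sum.simps(2))

lemma sum_inverse_weight_sum_square_le: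
  "(\<Sum>s<Suc m. 1 / (weight_sum s)\<^sup>2) \<le> 1 + ln (real m + 1) / 2"
proof (induction m)
  case (Suc m)
  have "1 / (weight_sum (Suc m))\<^sup>2 \<le> 1 / (2 * real m + 4)"
    using weight_sum_square_ge[of m] weight_sum_pos[of "Suc m"]
    by (intro divide_left_mono) auto
  also have "\<dots> = (1 - 1 / ((real m + 2) / (real m + 1))) / 2"
    by (simp add: field_simps)
  \<comment> \<open>\<open>ln y \<ge> 1 - 1 / y\<close>\<close>
  also have "1 - 1 / ((real m + 2) / (real m + 1)) \<le> ln ((real m + 2) / (real m + 1))"
    using ln_one_minus_pos_lower_bound ln_le_minus_one[of "(real m + 1) / (real m + 2)"]
    by (simp add: ln_div)
  also have "\<dots> = ln (real m + 2) - ln (real m + 1)"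
    by (simp add: ln_div)
  finally show ?case using Suc by (simp add: add.commute field_simps)
qed simp

lemma shifted_reference_point:
  fixes y z :: "'a::real_inner"
  assumes f: "convex_on X f" and y: "y \<in> X" and z: "z \<in> X" and \<mu>: "0 \<le> \<mu>" "\<mu> \<le> 1"
  obtains z' where "z' \<in> X" "f z' \<le> (1 - \<mu>) * f y + \<mu> * f z" "norm (y - z') = \<mu> * norm (y - z)"
proof
  let ?z = "(1 - \<mu>) *\<^sub>R y + \<mu> *\<^sub>R z"
  show "?z \<in> X"
    using convex_on_imp_convex[OF f] y z \<mu> by (simp add: convex_alt)
  show "f ?z \<le> (1 - \<mu>) * f y + \<mu> * f z"
    by (rule convex_onD[OF f]) (use y z \<mu> in auto)
  have "y - ?z = \<mu> *\<^sub>R (y - z)" by (simp add: algebra_simps)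
  then show "norm (y - ?z) = \<mu> * norm (y - z)" using \<mu> by simp
qed

text \<open>
  Backward induction with reference points: at \<open>s + 1\<close> steps before the end the potential
  \<open>\<bar>x - z\<bar>\<^sup>2 / V\<^sub>s\<^sup>2 + 2 \<eta> (V\<^bsub>s+1\<^esub> / V\<^sub>s) \<phi> z\<close>, with \<open>\<phi>\<close> the excess over the minimum, is bounded by
  the weighted excess of the current iterate plus the accumulated squared weights. It starts with
  \<open>z = x 1\<close>, where all terms vanish because \<open>x 1\<close> is a minimizer. After each step \<open>z\<close> is moved towards the new
  iterate, by a factor that keeps the weighted distance unchanged; the excess of the old iterate
  cancels and that of the new one appears, by convexity. The last iterate is reached with weight
  \<open>1\<close>, and its excess over \<open>z\<close> is absorbed by the squared distance.
\<close>

lemma excursion_le_log: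
  assumes inst: "problem_instance d X f L" and \<eta>: "\<eta> > 0" and tr: "trajectory d X f \<eta> n x"
    and n: "n \<ge> 2" and x1: "x 1 \<in> minimizers X f"
  shows "f (x n) - min_value X f \<le> (1 + ln (real n - 1) / 4) * (\<eta> * L\<^sup>2)"
proof -
  define \<phi> where "\<phi> y = f y - min_value X f" for y
  note X = trajectory_in[OF inst tr]
  have fX: "convex_on X f"
    using inst convex_on_subset[of "Rd d" f X] by (auto simp: problem_instance_def)
  have L: "L-lipschitz_on (Rd d) f" "X \<subseteq> Rd d"
    using inst by (auto simp: problem_instance_def)
  let ?V = weight_sum
  let ?P = "\<lambda>s z. (norm (x (n - 1 - s) - z))\<^sup>2 / (?V s)\<^sup>2 + 2 * \<eta> * (?V (Suc s) / ?V s) * \<phi> z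
      \<le> 2 * \<eta> * \<phi> (x (n - 1 - s)) / (?V s)\<^sup>2 + \<eta>\<^sup>2 * L\<^sup>2 * (\<Sum>t=Suc s..<n - 1. 1 / (?V t)\<^sup>2)"
  have "\<exists>z\<in>X. ?P s z" if "s \<le> n - 2" for s
    using that
  proof (induction s rule: inc_induct)
    case base
    have "\<phi> (x 1) = 0" by (simp add: \<phi>_def min_value_eq[OF x1])
    moreover have "n - 1 - (n - 2) = 1" using n by simp
    ultimately show ?case using X[of 1] n by (intro bexI[of _ "x 1"]) auto
  next
    case (step s)
    then obtain z where z: "z \<in> X" "?P (Suc s) z" by blast
    define k where "k = n - 1 - Suc s"
    have k: "1 \<le> k" "k < n" "n - 1 - s = Suc k" using step.hyps by (auto simp: k_def)
    define v v' v'' where "v = ?V s" and "v' = ?V (Suc s)" and "v'' = ?V (Suc (Suc s))"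
    have v: "v > 0" "v' = v + 1 / v" "v' > 0" "v'' = v' + 1 / v'"
      using weight_sum_pos[of s] weight_sum_pos[of "Suc s"] by (simp_all add: v_def v'_def v''_def weight_sum.simps(2))
    then have "v \<le> v'" by simp
    obtain z' where z': "z' \<in> X" "f z' \<le> (1 - v / v') * f (x (Suc k)) + v / v' * f z"
      "norm (x (Suc k) - z') = v / v' * norm (x (Suc k) - z)"
      using shifted_reference_point[OF fX X[of "Suc k"] z(1), of "v / v'"] k v \<open>v \<le> v'\<close> by auto
    have A: "(norm (x (Suc k) - z'))\<^sup>2 / v\<^sup>2 = (norm (x (Suc k) - z))\<^sup>2 / v'\<^sup>2"
      using v by (simp add: z'(3) power_mult_distrib power_divide)
    have "(norm (x (Suc k) - z))\<^sup>2
        \<le> (norm (x k - z))\<^sup>2 - 2 * \<eta> * (\<phi> (x k) - \<phi> z) + \<eta>\<^sup>2 * L\<^sup>2"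
      using trajectory_step[OF inst \<eta> tr k(1,2) z(1)] by (simp add: \<phi>_def)
    then have B: "(norm (x (Suc k) - z))\<^sup>2 / v'\<^sup>2
        \<le> ((norm (x k - z))\<^sup>2 - 2 * \<eta> * (\<phi> (x k) - \<phi> z) + \<eta>\<^sup>2 * L\<^sup>2) / v'\<^sup>2"
      by (rule divide_right_mono) simp
    have "\<phi> z' \<le> (1 - v / v') * \<phi> (x (Suc k)) + v / v' * \<phi> z"
      using z'(2) by (simp add: \<phi>_def algebra_simps)
    then have "v' / v * \<phi> z' \<le> v' / v * ((1 - v / v') * \<phi> (x (Suc k)) + v / v' * \<phi> z)"
      using v by (intro mult_left_mono) auto
    also have "\<dots> = (v' / v - 1) * \<phi> (x (Suc k)) + \<phi> z"
      using v(1,3) by (simp add: field_simps)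
    also have "v' / v - 1 = 1 / v\<^sup>2"
      using v(1) by (simp add: v(2) field_simps power2_eq_square)
    finally have "2 * \<eta> * (v' / v * \<phi> z') \<le> 2 * \<eta> * (1 / v\<^sup>2 * \<phi> (x (Suc k)) + \<phi> z)"
      using \<eta> by (intro mult_left_mono) auto
    then have C: "2 * \<eta> * (v' / v) * \<phi> z' \<le> 2 * \<eta> * \<phi> (x (Suc k)) / v\<^sup>2 + 2 * \<eta> * \<phi> z"
      by (simp add: algebra_simps)
    have D: "v'' / v' = 1 + 1 / v'\<^sup>2"
      using v(3) by (simp add: v(4) field_simps power2_eq_square)
    have E: "(norm (x k - z))\<^sup>2 / v'\<^sup>2 + 2 * \<eta> * (1 + 1 / v'\<^sup>2) * \<phi> z
      \<le> 2 * \<eta> * \<phi> (x k) / v'\<^sup>2 + \<eta>\<^sup>2 * L\<^sup>2 * (\<Sum>t=Suc (Suc s)..<n - 1. 1 / (?V t)\<^sup>2)"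
      using z(2) by (simp only: k_def[symmetric] v'_def[symmetric] v''_def[symmetric] D)
    have S: "(\<Sum>t=Suc s..<n - 1. 1 / (?V t)\<^sup>2) = 1 / v'\<^sup>2 + (\<Sum>t=Suc (Suc s)..<n - 1. 1 / (?V t)\<^sup>2)"
      using step.hyps by (simp add: sum.atLeast_Suc_lessThan v'_def)
    have "(norm (x (Suc k) - z'))\<^sup>2 / v\<^sup>2 + 2 * \<eta> * (v' / v) * \<phi> z'
      \<le> 2 * \<eta> * \<phi> (x (Suc k)) / v\<^sup>2 + \<eta>\<^sup>2 * L\<^sup>2 * (\<Sum>t=Suc s..<n - 1. 1 / (?V t)\<^sup>2)"
      unfolding A S using B C E by (simp add: algebra_simps add_divide_distrib diff_divide_distrib)
    then show ?case using z'(1) by (auto simp only: k(3) v_def v'_def)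
  qed
  then obtain z where z: "z \<in> X" "?P 0 z" by blast
  have V1: "?V (Suc 0) / ?V 0 = 2" by (simp add: weight_sum.simps(2))
  have n1: "Suc (n - 1) = n" using n by simp
  have "(norm (x n - z))\<^sup>2 \<le> (norm (x (n - 1) - z))\<^sup>2 - 2 * \<eta> * (\<phi> (x (n - 1)) - \<phi> z) + \<eta>\<^sup>2 * L\<^sup>2"
    using trajectory_step[OF inst \<eta> tr _ _ z(1), of "n - 1"] n by (simp add: \<phi>_def n1)
  moreover have "2 * \<eta> * (\<phi> (x n) - \<phi> z) \<le> (norm (x n - z))\<^sup>2 + \<eta>\<^sup>2 * L\<^sup>2"
  proof -
    have "f (x n) - f z \<le> L * norm (x n - z)"
      using lipschitz_onD[OF L(1), of "x n" z] L(2) X[of n] n z(1)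
      by (fastforce simp: dist_norm)
    then have "2 * \<eta> * (f (x n) - f z) \<le> 2 * \<eta> * (L * norm (x n - z))"
      using \<eta> by (intro mult_left_mono) auto
    moreover have "0 \<le> (\<eta> * L - norm (x n - z))\<^sup>2" by simp
    ultimately show ?thesis by (simp add: \<phi>_def power2_diff power_mult_distrib algebra_simps)
  qed
  moreover have "{..<n - 1} = insert 0 {Suc 0..<n - 1}" using n by auto
  then have "(\<Sum>t<n - 1. 1 / (?V t)\<^sup>2) = 1 + (\<Sum>t=Suc 0..<n - 1. 1 / (?V t)\<^sup>2)"
    by simp
  ultimately have "2 * \<eta> * \<phi> (x n) \<le> \<eta>\<^sup>2 * L\<^sup>2 * (1 + (\<Sum>t<n - 1. 1 / (?V t)\<^sup>2))"
    using z(2) V1 by (simp add: algebra_simps)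
  also have "\<dots> \<le> \<eta>\<^sup>2 * L\<^sup>2 * (1 + (1 + ln (real n - 1) / 2))"
    using sum_inverse_weight_sum_square_le[of "n - 2"] n
    by (intro mult_left_mono add_left_mono) (auto simp: Suc_diff_Suc numeral_2_eq_2 of_nat_diff)
  finally have "2 * \<eta> * \<phi> (x n) \<le> 2 * \<eta> * ((1 + ln (real n - 1) / 4) * (\<eta> * L\<^sup>2))"
    by (simp add: algebra_simps power2_eq_square)
  then show ?thesis using \<eta> by (simp add: \<phi>_def)
qed

section \<open>Instances with a large excursion\<close>

text \<open>
  The support function of \<open>G\<close>: its subgradients at \<open>y\<close> include the elements of \<open>G\<close> that attain the
  maximum, and its Lipschitz constant is the largest norm in \<open>G\<close>.
\<close>

definition support_max :: "fseq set \<Rightarrow> fseq \<Rightarrow> real" where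
  "support_max G y = Max ((\<lambda>g. inner g y) ` G)"

text \<open>
  A run of \<open>s\<close> unconstrained steps of unit size from the origin for the objective \<open>support_max G\<close>,
  with final value at least \<open>v\<close>. The bound \<open>\<Lambda>\<close> is on the square of the Lipschitz constant, which
  grows additively when orthogonal components are added to the subgradients. The requirement
  \<open>0 \<in> G\<close> makes the origin a minimizer and allows the run to wait there.
\<close>

definition excursion_system ::
    "nat \<Rightarrow> nat \<Rightarrow> real \<Rightarrow> real \<Rightarrow> fseq set \<Rightarrow> (nat \<Rightarrow> fseq) \<Rightarrow> bool" where
  "excursion_system d s \<Lambda> v G x \<longleftrightarrow>
     finite G \<and> 0 \<in> G \<and> G \<subseteq> Rd d \<and> (\<forall>g\<in>G. (norm g)\<^sup>2 \<le> \<Lambda>) \<and> x 0 = 0 \<and>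
     (\<forall>k<s. \<exists>g\<in>G. (\<forall>g'\<in>G. inner g' (x k) \<le> inner g (x k)) \<and> x (Suc k) = x k - g) \<and>
     (\<exists>g\<in>G. v \<le> inner g (x s))"

lemma excursion_system_in_Rd:
  assumes "excursion_system d s \<Lambda> v G x" "k \<le> s"
  shows "x k \<in> Rd d"
  using assms(2)
proof (induction k)
  case 0
  then show ?case using assms(1) by (simp add: excursion_system_def zero_in_Rd)
next
  case (Suc k)
  then obtain g where "g \<in> G" "x (Suc k) = x k - g"
    using assms(1) by (auto simp: excursion_system_def Suc_le_eq)
  with Suc show ?case using assms(1) by (auto simp: excursion_system_def intro!: diff_in_Rd)
qed

text \<open>
  The feasible set is the whole space. Horizons longer than \<open>s + 1\<close> are filled by waiting at the
  origin with the subgradient \<open>0\<close> before the run starts.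
\<close>

lemma excursion_system_instance:
  assumes sys: "excursion_system d s \<Lambda> v G x" and \<Lambda>: "\<Lambda> > 0" and d: "d \<le> d'" and n: "s < n"
  obtains X f L y where "L > 0" "problem_instance d' X f L" "y 1 \<in> minimizers X f"
    "trajectory d' X f 1 n y" "v / \<Lambda> \<le> (f (y n) - min_value X f) / L\<^sup>2"
proof -
  let ?f = "support_max G"
  have G: "finite G" "0 \<in> G" "G \<subseteq> Rd d'" "x 0 = 0"
    and norm_le: "\<And>g. g \<in> G \<Longrightarrow> norm g \<le> sqrt \<Lambda>"
    using sys Rd_mono[OF d] \<Lambda> by (auto simp: excursion_system_def intro: real_le_rsqrt)
  have ge: "inner g y \<le> ?f y" if "g \<in> G" for g y
    unfolding support_max_def using G that by (intro Max_ge) auto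
  have le: "?f y \<le> c" if "\<And>g. g \<in> G \<Longrightarrow> inner g y \<le> c" for y c
    unfolding support_max_def using G that by (subst Max_le_iff) auto
  have f0: "?f 0 = 0" and f_nonneg: "0 \<le> ?f y" for y
    using ge[OF G(2), of y] ge[OF G(2), of 0] le[of 0 0] by auto
  have convRd: "convex (Rd d')" by (rule subspace_imp_convex[OF subspace_Rd])
  have conv: "convex_on (Rd d') ?f"
  proof (rule convex_onI[OF _ convRd], rule le)
    fix t :: real and y z g assume t: "0 < t" "t < 1" and g: "g \<in> G"
    have "inner g ((1 - t) *\<^sub>R y + t *\<^sub>R z) = (1 - t) * inner g y + t * inner g z"
      by (simp add: inner_right_distrib)
    also have "\<dots> \<le> (1 - t) * ?f y + t * ?f z"
      using t ge[OF g] by (intro add_mono mult_left_mono) auto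
    finally show "inner g ((1 - t) *\<^sub>R y + t *\<^sub>R z) \<le> (1 - t) * ?f y + t * ?f z" .
  qed
  have lip1: "?f y \<le> ?f z + sqrt \<Lambda> * norm (y - z)" for y z
  proof (rule le)
    fix g assume g: "g \<in> G"
    have "inner g y = inner g z + inner g (y - z)" by (simp add: inner_diff_right)
    also have "inner g (y - z) \<le> norm g * norm (y - z)" by (rule norm_cauchy_schwarz)
    also have "\<dots> \<le> sqrt \<Lambda> * norm (y - z)" using norm_le[OF g] by (rule mult_right_mono) simp
    finally show "inner g y \<le> ?f z + sqrt \<Lambda> * norm (y - z)" using ge[OF g, of z] by simp
  qed
  have lip: "(sqrt \<Lambda>)-lipschitz_on (Rd d') ?f"
  proof (rule lipschitz_onI)
    show "dist (?f y) (?f z) \<le> sqrt \<Lambda> * dist y z" for y z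
      using lip1[of y z] lip1[of z y] by (simp add: dist_norm norm_minus_commute[of z y] abs_le_iff)
  qed (use \<Lambda> in simp)
  have min0: "0 \<in> minimizers (Rd d') ?f"
    using f0 f_nonneg by (simp add: minimizers_def is_arg_min_linorder zero_in_Rd)
  have proj_id: "proj (Rd d') y = y" if "y \<in> Rd d'" for y
    using proj_le[OF order_refl closed_Rd _ convRd that, of y] that by auto
  define y where "y k = x (k - (n - s))" for k
  have step: "\<exists>g\<in>subdifferential d' ?f (y k). y (Suc k) = proj (Rd d') (y k - 1 *\<^sub>R g)"
    if k: "1 \<le> k" "k < n" for k
  proof -
    obtain g where g: "g \<in> G" "\<forall>g'\<in>G. inner g' (y k) \<le> inner g (y k)" "y (Suc k) = y k - g"
    proof (cases "k < n - s")
      case True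
      then show ?thesis using that[of 0] G by (simp add: y_def)
    next
      case False
      then have "k - (n - s) < s" "Suc k - (n - s) = Suc (k - (n - s))" using k n by auto
      then show ?thesis using that sys by (auto simp: excursion_system_def y_def)
    qed
    have "y k \<in> Rd d'"
      unfolding y_def using excursion_system_in_Rd[OF sys, of "k - (n - s)"] k n Rd_mono[OF d] by auto
    then have "y k - g \<in> Rd d'" using g(1) G(3) by (intro diff_in_Rd) auto
    moreover have "?f (y k) = inner g (y k)" using ge[OF g(1)] le[of "y k"] g(2) by (intro antisym) auto
    then have "g \<in> subdifferential d' ?f (y k)"
      using g(1) G(3) ge[OF g(1)] by (auto simp: subdifferential_def inner_diff_right)
    ultimately show ?thesis using g(3) proj_id by (intro bexI[of _ g]) auto
  qed
  show ?thesis
  proof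
    show "sqrt \<Lambda> > 0" using \<Lambda> by simp
    show "problem_instance d' (Rd d') ?f (sqrt \<Lambda>)"
      using zero_in_Rd[of d'] closed_Rd convRd conv lip min0 by (auto simp: problem_instance_def)
    have "1 - (n - s) = 0" using n by simp
    then have y1: "y 1 = 0" by (simp add: y_def G)
    then show "y 1 \<in> minimizers (Rd d') ?f" using min0 by simp
    show "trajectory d' (Rd d') ?f 1 n y"
      using step y1 zero_in_Rd by (auto simp: trajectory_def)
    have "y n = x s" using n by (simp add: y_def)
    moreover obtain g where "g \<in> G" "v \<le> inner g (x s)" using sys by (auto simp: excursion_system_def)
    ultimately have "v \<le> ?f (y n)" using ge[of g "x s"] by simp
    then show "v / \<Lambda> \<le> (?f (y n) - min_value (Rd d') ?f) / (sqrt \<Lambda>)\<^sup>2"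
      using \<Lambda> by (simp add: min_value_eq[OF min0] f0 divide_right_mono)
  qed
qed

text \<open>The absolute value on the line: one step leaves the minimizer at full speed.\<close>

lemma excursion_system_base:
  "excursion_system 1 1 1 1 {0, unit_vec 0, - unit_vec 0} (\<lambda>k. - real k *\<^sub>R unit_vec 0)"
  unfolding excursion_system_def
  by (auto simp: zero_in_Rd unit_vec_in_Rd power2_norm_eq_inner inner_unit_vec_left coord_simps
      coord_unit_vec less_Suc_eq intro!: subspace_neg[OF subspace_Rd])

text \<open>
  The new objective is \<open>max {0, \<bar>q\<bar> / 2, \<bar>q\<bar> - a p, a p + f}\<close> with \<open>a = 1 / (2 sqrt N)\<close>. From the origin
  the subgradient \<open>q / 2\<close> leads to the wall \<open>\<bar>q\<bar> = 1 / 2\<close>. There the second term is active; its steps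
  flip the sign of \<open>q\<close> and increase \<open>p\<close> by \<open>a\<close>. After \<open>N\<close> of them \<open>a p = N a\<^sup>2 = 1 / 4\<close>, all terms with
  \<open>q\<close> or \<open>p\<close> agree, and a subgradient of \<open>\<bar>q\<bar> / 2\<close> leads back to \<open>q = 0\<close>. From then on only the last term
  matters: the old trajectory is run while \<open>a p\<close> decreases from \<open>1 / 4\<close> by \<open>a\<^sup>2 = 1 / (4 N)\<close> per step,
  which stays nonnegative because \<open>s \<le> N\<close>.
\<close>

lemma excursion_system_extend:
  assumes sys: "excursion_system d s \<Lambda> v G x" and \<Lambda>: "\<Lambda> \<ge> 1" and N: "N \<ge> s" "N \<ge> 1"
  obtains G' x' where
    "excursion_system (d + 2) (s + N + 2) (\<Lambda> + 1 / (4 * real N)) (v + 1 / 4 - real s / (4 * real N)) G' x'"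
proof -
  define a where "a = 1 / (2 * sqrt (real N))"
  have a2: "a * a = 1 / (4 * real N)" using N by (simp add: a_def)
  have Na2: "real N * (a * a) = 1 / 4" using N by (simp add: a2)
  define p q where "p = unit_vec d" and "q = unit_vec (d + 1)"
  define \<sigma> :: "nat \<Rightarrow> real" where "\<sigma> j = (-1) ^ j" for j
  have \<sigma>: "\<sigma> (Suc j) = - \<sigma> j" "\<sigma> j = 1 \<or> \<sigma> j = -1" for j
    by (simp_all add: \<sigma>_def minus_one_power_iff)
  have pq: "inner p p = 1" "inner q q = 1" "inner p q = 0" "inner q p = 0"
    by (simp_all add: p_def q_def inner_unit_vec_left coord_unit_vec)
  have perp: "inner p w = 0" "inner q w = 0" "inner w p = 0" "inner w q = 0" if "w \<in> Rd d" for w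
    using that by (simp_all add: p_def q_def inner_unit_vec_left inner_unit_vec_right Rd_def)
  have G: "finite G" "0 \<in> G" "G \<subseteq> Rd d" "\<And>g. g \<in> G \<Longrightarrow> (norm g)\<^sup>2 \<le> \<Lambda>" "x 0 = 0"
    and step: "\<And>k. k < s \<Longrightarrow>
      \<exists>g\<in>G. (\<forall>g'\<in>G. inner g' (x k) \<le> inner g (x k)) \<and> x (Suc k) = x k - g"
    using sys by (auto simp: excursion_system_def)
  define G' where "G' = {0, (1 / 2) *\<^sub>R q, - (1 / 2) *\<^sub>R q, q - a *\<^sub>R p, - q - a *\<^sub>R p}
      \<union> (\<lambda>g. g + a *\<^sub>R p) ` G"
  define x' where "x' k =
    (if k = 0 then 0
     else if k \<le> N + 1 then (real (k - 1) * a) *\<^sub>R p - (\<sigma> (k - 1) / 2) *\<^sub>R q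
     else ((real N - real (k - (N + 2))) * a) *\<^sub>R p + x (k - (N + 2)))" for k
  have le_G': "inner g' (\<alpha> *\<^sub>R p + \<beta> *\<^sub>R q + w) \<le> M"
    if "g' \<in> G'" "w \<in> Rd d" "0 \<le> M" "\<bar>\<beta>\<bar> / 2 \<le> M" "\<bar>\<beta>\<bar> - a * \<alpha> \<le> M"
      "\<And>g. g \<in> G \<Longrightarrow> inner g w + a * \<alpha> \<le> M" for g' \<alpha> \<beta> w M
  proof -
    have gw: "inner g p = 0" "inner g q = 0" if "g \<in> G" for g
      using perp[of g] that G(3) by auto
    show ?thesis
      using that(1,3-6) unfolding G'_def
      by (auto simp: inner_simps pq perp[OF that(2)] gw mult.commute[of a] add.commute)
  qed
  have x'_step: "\<exists>g\<in>G'. (\<forall>g'\<in>G'. inner g' (x' k) \<le> inner g (x' k)) \<and> x' (Suc k) = x' k - g"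
    if k: "k < s + N + 2" for k
  proof -
    consider "k = 0" | j where "k = Suc j" "j < N" | "k = Suc N" | i where "k = N + 2 + i" "i < s"
    proof -
      have "k = 0 \<or> (\<exists>j. k = Suc j \<and> j < N) \<or> k = Suc N \<or> (\<exists>i. k = N + 2 + i \<and> i < s)"
        using k by presburger
      then show ?thesis using that by blast
    qed
    then show ?thesis
    proof cases
      case 1
      have "\<forall>g'\<in>G'. inner g' (x' k) \<le> inner ((1 / 2) *\<^sub>R q) (x' k)" by (simp add: 1 x'_def)
      moreover have "x' (Suc k) = x' k - (1 / 2) *\<^sub>R q" by (simp add: 1 x'_def \<sigma>_def)
      ultimately show ?thesis by (intro bexI[of _ "(1 / 2) *\<^sub>R q"]) (auto simp: G'_def)
    next
      case (2 j)
      define g where "g = - \<sigma> j *\<^sub>R q - a *\<^sub>R p"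
      have xk: "x' k = (real j * a) *\<^sub>R p + (- \<sigma> j / 2) *\<^sub>R q + 0"
        using 2 by (simp add: x'_def)
      have "real j * (a * a) \<le> real N * (a * a)" using 2 by (intro mult_right_mono) auto
      then have ja: "a * (real j * a) \<le> 1 / 4" using Na2 by (simp add: mult_ac)
      have gx: "inner g (x' k) = 1 / 2 - a * (real j * a)"
        using \<sigma>(2)[of j] by (auto simp: xk g_def inner_simps pq)
      have abs: "\<bar>- \<sigma> j / 2\<bar> = 1 / 2" using \<sigma>(2)[of j] by auto
      have "inner g' (x' k) \<le> inner g (x' k)" if "g' \<in> G'" for g'
        unfolding gx unfolding xk
        by (rule le_G'[OF that zero_in_Rd]) (use ja abs in \<open>auto simp: mult_ac\<close>)
      moreover have "x' (Suc k) = x' k - g"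
        using 2 \<sigma>(1)[of j] by (simp add: xk g_def x'_def algebra_simps)
           (simp add: scaleR_add_left[symmetric])
      moreover have "g \<in> G'" using \<sigma>(2)[of j] by (auto simp: g_def G'_def)
      ultimately show ?thesis by blast
    next
      case 3
      define g where "g = (- \<sigma> N / 2) *\<^sub>R q"
      have xk: "x' k = (real N * a) *\<^sub>R p + (- \<sigma> N / 2) *\<^sub>R q + 0"
        using 3 by (simp add: x'_def)
      have Na: "a * (real N * a) = 1 / 4" using Na2 by (simp add: mult_ac)
      have gx: "inner g (x' k) = 1 / 4"
        using \<sigma>(2)[of N] by (auto simp: xk g_def inner_simps pq)
      have abs: "\<bar>- \<sigma> N / 2\<bar> = 1 / 2" using \<sigma>(2)[of N] by auto
      have "inner g' (x' k) \<le> inner g (x' k)" if "g' \<in> G'" for g'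
        unfolding gx unfolding xk
        by (rule le_G'[OF that zero_in_Rd]) (use Na abs in auto)
      moreover have "x' (Suc k) = x' k - g"
        using 3 G(5) by (simp add: xk g_def x'_def)
      moreover have "g \<in> G'" using \<sigma>(2)[of N] by (auto simp: g_def G'_def)
      ultimately show ?thesis by blast
    next
      case (4 i)
      obtain h where h: "h \<in> G" "\<forall>g'\<in>G. inner g' (x i) \<le> inner h (x i)" "x (Suc i) = x i - h"
        using step[OF 4(2)] by blast
      define g where "g = h + a *\<^sub>R p"
      have xi: "x i \<in> Rd d" using excursion_system_in_Rd[OF sys] 4 by simp
      have hRd: "h \<in> Rd d" using h(1) G(3) by auto
      define \<alpha> where "\<alpha> = (real N - real i) * a"
      have xk: "x' k = \<alpha> *\<^sub>R p + 0 *\<^sub>R q + x i"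
        using 4 by (simp add: x'_def \<alpha>_def)
      have gx: "inner g (x' k) = inner h (x i) + a * \<alpha>"
        by (simp add: xk g_def inner_simps pq perp[OF xi] perp[OF hRd])
      have "0 \<le> a * \<alpha>" using 4 N by (simp add: a_def \<alpha>_def)
      then have pos: "0 \<le> a * \<alpha>" "0 \<le> \<alpha> * a" by (simp_all only: mult.commute)
      have h0: "0 \<le> inner h (x i)" using h(2) G(2) by force
      have "inner g' (x' k) \<le> inner g (x' k)" if "g' \<in> G'" for g'
        unfolding gx unfolding xk
        by (rule le_G'[OF that xi]) (use pos h0 h(2) in auto)
      moreover have "x' (Suc k) = x' k - g"
        using 4 h(3) by (simp add: xk g_def x'_def Suc_diff_le \<alpha>_def algebra_simps)
      moreover have "g \<in> G'" using h(1) by (auto simp: g_def G'_def)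
      ultimately show ?thesis by blast
    qed
  qed
  have "finite G'" "0 \<in> G'" using G by (auto simp: G'_def)
  moreover have "G' \<subseteq> Rd (d + 2)"
    using G(3) by (auto simp: G'_def p_def q_def Rd_def coord_simps coord_unit_vec)
  moreover have "(norm g)\<^sup>2 \<le> \<Lambda> + 1 / (4 * real N)" if "g \<in> G'" for g
  proof -
    have "(norm (h + a *\<^sub>R p))\<^sup>2 = (norm h)\<^sup>2 + 1 / (4 * real N)" if "h \<in> G" for h
      using perp[of h] that G(3)
      by (auto simp: power2_norm_eq_inner inner_simps pq a2[symmetric])
    then have "(norm (h + a *\<^sub>R p))\<^sup>2 \<le> \<Lambda> + 1 / (4 * real N)" if "h \<in> G" for h
      using G(4)[OF that] that by simp
    moreover have "(norm ((1 / 2) *\<^sub>R q))\<^sup>2 = 1 / 4" "(norm (- (1 / 2) *\<^sub>R q))\<^sup>2 = 1 / 4"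
      "(norm (q - a *\<^sub>R p))\<^sup>2 = 1 + 1 / (4 * real N)"
      "(norm (- q - a *\<^sub>R p))\<^sup>2 = 1 + 1 / (4 * real N)" "(norm (0 :: fseq))\<^sup>2 = 0"
      by (simp_all only: power2_norm_eq_inner) (simp_all add: inner_simps pq a2)
    moreover have "1 / 4 \<le> \<Lambda> + 1 / (4 * real N)" "0 \<le> \<Lambda> + 1 / (4 * real N)"
      "1 + 1 / (4 * real N) \<le> \<Lambda> + 1 / (4 * real N)"
      using \<Lambda> by (simp_all add: add_increasing2 add_nonneg_nonneg)
    moreover have "g \<in> {0, (1 / 2) *\<^sub>R q, - (1 / 2) *\<^sub>R q, q - a *\<^sub>R p, - q - a *\<^sub>R p}
        \<or> (\<exists>h\<in>G. g = h + a *\<^sub>R p)"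
      using \<open>g \<in> G'\<close> by (auto simp: G'_def)
    ultimately show ?thesis
      by (elim disjE insertE bexE emptyE) (simp_all only:)
  qed
  moreover have "x' 0 = 0" by (simp add: x'_def)
  moreover have "\<exists>g\<in>G'. v + 1 / 4 - real s / (4 * real N) \<le> inner g (x' (s + N + 2))"
  proof -
    obtain h where h: "h \<in> G" "v \<le> inner h (x s)" using sys by (auto simp: excursion_system_def)
    have "x s \<in> Rd d" "h \<in> Rd d" using excursion_system_in_Rd[OF sys, of s] h G(3) by auto
    then have "inner (h + a *\<^sub>R p) (x' (s + N + 2)) = inner h (x s) + (real N - real s) * (a * a)"
      by (simp add: x'_def inner_simps pq perp)
    also have "(real N - real s) * (a * a) = 1 / 4 - real s / (4 * real N)"
      using N by (simp add: a2 field_simps)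
    finally show ?thesis using h by (intro bexI[of _ "h + a *\<^sub>R p"]) (auto simp: G'_def)
  qed
  ultimately have "excursion_system (d + 2) (s + N + 2) (\<Lambda> + 1 / (4 * real N))
      (v + 1 / 4 - real s / (4 * real N)) G' x'"
    using x'_step by (simp add: excursion_system_def)
  then show ?thesis by (rule that)
qed

text \<open>
  Each extension is made \<open>K\<close> times as long as the run so far. The gain is then
  \<open>1 / 4 - 1 / (4 K)\<close>, and since the lengths at least double, the increments \<open>1 / (4 K s)\<close> of
  \<open>\<Lambda>\<close> form a convergent series; the term \<open>- 1 / (2 K s)\<close> in the invariant pays for its tail.
\<close>

lemma excursion_system_iterate:
  assumes K: "K \<ge> 2"
  shows "\<exists>s \<Lambda> G x. excursion_system (2 * m + 1) s \<Lambda> (1 + real m * (1 / 4 - 1 / (4 * real K))) G x \<and>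
    1 \<le> \<Lambda> \<and> \<Lambda> \<le> 1 + 1 / (2 * real K) - 1 / (2 * real K * real s) \<and>
    1 \<le> s \<and> s + 1 \<le> 2 * (K + 1) ^ m"
proof (induction m)
  case 0
  show ?case
    using excursion_system_base
    by (intro exI[of _ 1] exI[of _ "{0, unit_vec 0, - unit_vec 0}"]
        exI[of _ "\<lambda>k. - real k *\<^sub>R unit_vec 0"]) simp
next
  case (Suc m)
  then obtain s \<Lambda> G x where sys:
      "excursion_system (2 * m + 1) s \<Lambda> (1 + real m * (1 / 4 - 1 / (4 * real K))) G x"
    and \<Lambda>: "1 \<le> \<Lambda>" "\<Lambda> \<le> 1 + 1 / (2 * real K) - 1 / (2 * real K * real s)"
    and s: "1 \<le> s" "s + 1 \<le> 2 * (K + 1) ^ m" by blast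
  define s' where "s' = s + K * s + 2"
  have N: "s \<le> K * s" "1 \<le> K * s" using K s(1) by auto
  obtain G' x' where sys': "excursion_system (2 * m + 1 + 2) s' (\<Lambda> + 1 / (4 * real (K * s)))
      (1 + real m * (1 / 4 - 1 / (4 * real K)) + 1 / 4 - real s / (4 * real (K * s))) G' x'"
    using excursion_system_extend[OF sys \<Lambda>(1) N] by (auto simp: s'_def)
  have "1 + real m * (1 / 4 - 1 / (4 * real K)) + 1 / 4 - real s / (4 * real (K * s))
      = 1 + real (Suc m) * (1 / 4 - 1 / (4 * real K))"
    using s(1) K by (simp add: field_simps)
  then have sys'': "excursion_system (2 * Suc m + 1) s' (\<Lambda> + 1 / (4 * real (K * s)))
      (1 + real (Suc m) * (1 / 4 - 1 / (4 * real K))) G' x'"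
    using sys' by (simp add: add.commute)
  have "2 * s \<le> s'" using N(1) unfolding s'_def by linarith
  then have "2 * real s \<le> real s'" by linarith
  then have "1 / (2 * real K * real s') \<le> 1 / (2 * real K * (2 * real s))"
    using K s(1) by (intro divide_left_mono mult_left_mono mult_pos_pos) auto
  moreover have "1 / (2 * real K * (2 * real s)) = 1 / (2 * real K * real s) - 1 / (4 * real (K * s))"
    using K s(1) by (simp add: field_simps)
  ultimately have "\<Lambda> + 1 / (4 * real (K * s)) \<le> 1 + 1 / (2 * real K) - 1 / (2 * real K * real s')"
    using \<Lambda>(2) by linarith
  moreover have "1 \<le> \<Lambda> + 1 / (4 * real (K * s))" using \<Lambda>(1) by (simp add: add_increasing2)
  moreover have "s' + 1 \<le> 2 * (K + 1) ^ Suc m"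
  proof -
    have "s' + 1 \<le> (K + 1) * (s + 1)" using K by (simp add: s'_def algebra_simps)
    also have "\<dots> \<le> (K + 1) * (2 * (K + 1) ^ m)" using s(2) by (rule mult_le_mono2)
    finally show ?thesis by (simp add: mult_ac)
  qed
  moreover have "1 \<le> s'" by (simp add: s'_def)
  ultimately show ?case using sys'' by blast
qed

lemma large_excursion_instance:
  assumes K: "K \<ge> 2" and d: "2 * m + 1 \<le> d" and n: "2 * (K + 1) ^ m \<le> n"
  obtains X f L y where "L > 0" "problem_instance d X f L" "y 1 \<in> minimizers X f"
    "trajectory d X f 1 n y"
    "(1 + real m * (1 / 4 - 1 / (4 * real K))) / (1 + 1 / (2 * real K))
      \<le> (f (y n) - min_value X f) / L\<^sup>2"
proof -
  let ?v = "1 + real m * (1 / 4 - 1 / (4 * real K))"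
  obtain s \<Lambda> G x where sys: "excursion_system (2 * m + 1) s \<Lambda> ?v G x"
    and \<Lambda>: "1 \<le> \<Lambda>" "\<Lambda> \<le> 1 + 1 / (2 * real K) - 1 / (2 * real K * real s)"
    and s: "s + 1 \<le> 2 * (K + 1) ^ m"
    using excursion_system_iterate[OF K, of m] by blast
  have "0 \<le> 1 / (2 * real K * real s)" by simp
  then have \<Lambda>': "\<Lambda> \<le> 1 + 1 / (2 * real K)" using \<Lambda>(2) by linarith
  have "0 \<le> 1 / 4 - 1 / (4 * real K)" using K by (simp add: field_simps)
  then have "0 \<le> real m * (1 / 4 - 1 / (4 * real K))" by simp
  then have "?v / (1 + 1 / (2 * real K)) \<le> ?v / \<Lambda>"
    using \<Lambda>(1) \<Lambda>' by (intro divide_left_mono mult_pos_pos) auto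
  moreover obtain X f L y where "L > 0" "problem_instance d X f L" "y 1 \<in> minimizers X f"
    "trajectory d X f 1 n y" "?v / \<Lambda> \<le> (f (y n) - min_value X f) / L\<^sup>2"
    by (rule excursion_system_instance[OF sys _ d, of n]) (use \<Lambda>(1) s n in auto)
  ultimately show ?thesis using that by (meson order_trans)
qed

section \<open>Bounds on the anytime constant and on the worst-case excursion\<close>

lemma anytime_const_ge_excursion:
  assumes A: "anytime_const d A" and n: "n \<ge> 1"
    and inst: "L > 0" "problem_instance d X f L" "y 1 \<in> minimizers X f" "trajectory d X f 1 n y"
  shows "(f (y n) - min_value X f) / L\<^sup>2 \<le> A"
proof -
  have "f (y n) - min_value X f \<le> A * 1 * L\<^sup>2
      + (infdist (y 1) (minimizers X f))\<^sup>2 / (2 * real n * 1)"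
    using anytime_constD[OF A inst(2) _ inst(4) n] by simp
  then show ?thesis using inst(1,3) by (simp add: field_simps)
qed

lemma anytime_const_ge_1:
  assumes "anytime_const d A" "d \<ge> 1"
  shows "1 \<le> A"
proof -
  obtain X f L y where i: "L > 0" "problem_instance d X f L" "y 1 \<in> minimizers X f"
    "trajectory d X f 1 2 y" "1 / 1 \<le> (f (y 2) - min_value X f) / L\<^sup>2"
    by (rule excursion_system_instance[OF excursion_system_base _ assms(2), of 2]) auto
  then show ?thesis
    using anytime_const_ge_excursion[OF assms(1) one_le_numeral i(1-4)] by linarith
qed

text \<open>
  With \<open>K = m + 2\<close> the losses in the gains and in the Lipschitz constant are smaller than the
  excursion \<open>1\<close> of the initial one-dimensional instance.
\<close>

lemma anytime_const_ge_quarter: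
  assumes "anytime_const d A" "2 * m + 1 \<le> d"
  shows "real m / 4 \<le> A"
proof -
  let ?K = "m + 2"
  let ?n = "2 * (?K + 1) ^ m"
  obtain X f L y where i: "L > 0" "problem_instance d X f L" "y 1 \<in> minimizers X f"
    "trajectory d X f 1 ?n y"
    "(1 + real m * (1 / 4 - 1 / (4 * real ?K))) / (1 + 1 / (2 * real ?K))
      \<le> (f (y ?n) - min_value X f) / L\<^sup>2"
    by (rule large_excursion_instance[OF _ assms(2) order_refl, of ?K]) simp
  define \<rho> where "\<rho> = real m / real ?K"
  have "\<rho> \<le> 1" by (simp add: \<rho>_def)
  moreover have "real m / 4 * (1 + 1 / (2 * real ?K)) = real m / 4 + \<rho> / 8"
    by (simp add: \<rho>_def distrib_left)
  moreover have "1 + real m * (1 / 4 - 1 / (4 * real ?K)) = 1 + real m / 4 - \<rho> / 4"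
    by (simp add: \<rho>_def right_diff_distrib)
  ultimately have "real m / 4 * (1 + 1 / (2 * real ?K)) \<le> 1 + real m * (1 / 4 - 1 / (4 * real ?K))"
    by linarith
  moreover have "0 < 1 + 1 / (2 * real ?K)" by (simp add: add_pos_nonneg)
  ultimately have "real m / 4 \<le> (1 + real m * (1 / 4 - 1 / (4 * real ?K))) / (1 + 1 / (2 * real ?K))"
    by (simp only: pos_le_divide_eq)
  also note i(5)
  also have "(f (y ?n) - min_value X f) / L\<^sup>2 \<le> A"
    using anytime_const_ge_excursion[OF assms(1) _ i(1-4)] by simp
  finally show ?thesis .
qed

text \<open>
  The infimum of the admissible constants is admissible, since each of the defining inequalities is
  closed and monotone in \<open>A\<close>.
\<close>

lemma A_star_is_least:
  assumes d: "d \<ge> 1"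
  shows "anytime_const d (A_star d)" and "anytime_const d A \<Longrightarrow> A_star d \<le> A"
proof -
  define S where "S = Collect (anytime_const d)"
  define A0 where "A0 = Inf S"
  have S: "2 * real d + 1 / 2 \<in> S" "S \<noteq> {}"
    using anytime_const_dimension[OF d] by (auto simp: S_def)
  have ge0: "A \<in> S \<Longrightarrow> 0 \<le> A" for A by (simp add: S_def anytime_const_def)
  then have bdd: "bdd_below S" by (rule bdd_belowI)
  have lower: "A0 \<le> A" if "anytime_const d A" for A
    unfolding A0_def using that bdd by (intro cInf_lower) (auto simp: S_def)
  have "anytime_const d A0"
    unfolding anytime_const_def
  proof (intro conjI allI impI, goal_cases)
    case 1
    show ?case unfolding A0_def using S(2) ge0 by (intro cInf_greatest) auto
  next
    case (2 n X f L \<eta> x)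
    define c where "c = f (x n) - min_value X f
        - (infdist (x 1) (minimizers X f))\<^sup>2 / (2 * real n * \<eta>)"
    define u where "u = \<eta> * L\<^sup>2"
    have le: "c \<le> A * u" if "A \<in> S" for A
    proof -
      have "f (x n) - min_value X f
          \<le> A * \<eta> * L\<^sup>2 + (infdist (x 1) (minimizers X f))\<^sup>2 / (2 * real n * \<eta>)"
        using anytime_constD[of d A X f L \<eta> n x] that 2 by (auto simp: S_def)
      then show ?thesis by (simp add: c_def u_def mult.assoc)
    qed
    have "c \<le> A0 * u"
    proof (cases "u = 0")
      case True
      then show ?thesis using le[OF S(1)] by simp
    next
      case False
      then have u: "u > 0" using 2 by (simp add: u_def)
      have "c / u \<le> A0"
        unfolding A0_def using S(2)
        by (rule cInf_greatest) (use le u in \<open>simp add: pos_divide_le_eq\<close>)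
      then show ?thesis using u by (simp add: pos_divide_le_eq)
    qed
    then show ?case by (simp add: c_def u_def mult.assoc)
  qed
  then have "A_star d = A0"
    unfolding A_star_def by (rule Least_equality) (rule lower)
  with \<open>anytime_const d A0\<close> lower
  show "anytime_const d (A_star d)" and "anytime_const d A \<Longrightarrow> A_star d \<le> A" by auto
qed

lemma Gamma_sup_upper:
  assumes d: "d \<ge> 1" and n: "n \<ge> 2"
  shows "Gamma_sup d n \<le> ereal (min (2 * real d + 1 / 2) (1 + ln (real n - 1) / 4))"
  unfolding Gamma_sup_def
proof (rule Sup_least, clarify)
  fix \<eta> L :: real and X f x
  assume i: "\<eta> > 0" "L > 0" "problem_instance d X f L" "x 1 \<in> minimizers X f"
    "trajectory d X f \<eta> n x"
  have "f (x n) - min_value X f \<le> (2 * real d + 1 / 2) * \<eta> * L\<^sup>2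
      + (infdist (x 1) (minimizers X f))\<^sup>2 / (2 * real n * \<eta>)"
    using anytime_constD[OF anytime_const_dimension[OF d] i(3,1,5)] n by simp
  moreover have "f (x n) - min_value X f \<le> (1 + ln (real n - 1) / 4) * (\<eta> * L\<^sup>2)"
    using excursion_le_log i n by blast
  ultimately have "(f (x n) - min_value X f) / (\<eta> * L\<^sup>2) \<le> 2 * real d + 1 / 2"
    "(f (x n) - min_value X f) / (\<eta> * L\<^sup>2) \<le> 1 + ln (real n - 1) / 4"
    using i by (simp_all add: pos_divide_le_eq mult.assoc)
  then show "ereal ((f (x n) - min_value X f) / (\<eta> * L\<^sup>2))
      \<le> ereal (min (2 * real d + 1 / 2) (1 + ln (real n - 1) / 4))" by simp
qed

text \<open>
  For \<open>K = 2\<close> the horizon \<open>2 * 3 ^ m\<close> and \<open>2 m + 1\<close> dimensions give an excursion of at least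
  \<open>(m + 1) / 10\<close>; the largest \<open>m\<close> that fits is taken.
\<close>

lemma Gamma_sup_lower:
  assumes d: "d \<ge> 1" and n: "n \<ge> 2"
  shows "ereal (1 / 40 * min (real d) (ln (real n + 1))) \<le> Gamma_sup d n"
proof -
  obtain l where l: "2 * 3 ^ l \<le> n" "n < 2 * 3 ^ Suc l"
  proof -
    have "n < 2 ^ n" by (rule less_exp)
    also have "\<dots> \<le> 3 ^ n" by (rule power_mono) auto
    also have "\<dots> \<le> 2 * 3 ^ n" by simp
    finally have "\<exists>l. n < 2 * 3 ^ l" by blast
    then obtain k where k: "n < 2 * 3 ^ k" "\<And>j. j < k \<Longrightarrow> \<not> n < 2 * 3 ^ j"
      using exists_least_iff[of "\<lambda>l. n < 2 * 3 ^ l"] by blast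
    then have "k \<noteq> 0" using n by (cases k) auto
    then show ?thesis using that[of "k - 1"] k(1) k(2)[of "k - 1"] by (cases k) auto
  qed
  define m where "m = min ((d - 1) div 2) l"
  have "3 ^ m \<le> (3 :: nat) ^ l" by (rule power_increasing) (simp_all add: m_def)
  then have "2 * 3 ^ m \<le> n" using l(1) by linarith
  then have n_ge: "2 * (2 + 1) ^ m \<le> n" by simp
  have d_ge: "2 * m + 1 \<le> d" using d by (simp add: m_def)
  obtain X f L y where i: "L > 0" "problem_instance d X f L" "y 1 \<in> minimizers X f"
    "trajectory d X f 1 n y"
    "(1 + real m * (1 / 4 - 1 / (4 * real 2))) / (1 + 1 / (2 * real 2))
      \<le> (f (y n) - min_value X f) / L\<^sup>2"
    by (rule large_excursion_instance[OF order_refl d_ge n_ge])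
  have "min (real d) (ln (real n + 1)) \<le> 4 * (real m + 1)"
  proof (cases "m = l")
    case True
    have "n + 1 \<le> 3 ^ (l + 2)" using l(2) by simp
    then have "real (n + 1) \<le> real (3 ^ (l + 2))" by (simp only: of_nat_le_iff)
    then have "real n + 1 \<le> 3 ^ (l + 2)"
      by (simp only: of_nat_power of_nat_numeral of_nat_add of_nat_1)
    then have "ln (real n + 1) \<le> ln (3 ^ (l + 2))" by (subst ln_le_cancel_iff) auto
    also have "\<dots> = real (l + 2) * ln 3" by (rule ln_realpow)
    also have "\<dots> \<le> real (l + 2) * 2"
      using ln_le_minus_one[of "3 :: real"] by (intro mult_left_mono) auto
    finally show ?thesis using True by simp
  next
    case False
    then have "m = (d - 1) div 2" by (auto simp: m_def)
    then have "real d \<le> 2 * real m + 2" by linarith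
    then have "real d \<le> 4 * (real m + 1)" using of_nat_0_le_iff[of m] by (simp add: algebra_simps)
    then show ?thesis by (rule min.coboundedI1)
  qed
  then have "1 / 40 * min (real d) (ln (real n + 1))
      \<le> (1 + real m * (1 / 4 - 1 / (4 * real 2))) / (1 + 1 / (2 * real 2))" by simp
  also note i(5)
  finally have "ereal (1 / 40 * min (real d) (ln (real n + 1)))
      \<le> ereal ((f (y n) - min_value X f) / (1 * L\<^sup>2))" by simp
  also have "\<dots> \<le> Gamma_sup d n"
    unfolding Gamma_sup_def using i(1-4)
    by (intro Sup_upper CollectI exI[of _ 1] exI[of _ L] exI[of _ X] exI[of _ f] exI[of _ y]) auto
  finally show ?thesis .
qed

lemma bounds_comparable:
  assumes d: "d \<ge> 1" and n: "n \<ge> 2"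
  shows "min (2 * real d + 1 / 2) (1 + ln (real n - 1) / 4) \<le> 5 / 2 * min (real d) (ln (real n + 1))"
proof -
  have "(1 :: real) = ln (exp 1)" by simp
  also have "\<dots> \<le> ln (real n + 1)"
    using n exp_le by (subst ln_le_cancel_iff) auto
  finally have "1 \<le> ln (real n + 1)" .
  moreover have "ln (real n - 1) \<le> ln (real n + 1)" using n by (subst ln_le_cancel_iff) auto
  ultimately show ?thesis using d by (simp add: min_def)
qed

theorem corollary4:
  shows
    "(\<exists>c0>0. \<exists>C0>0. \<forall>d::nat. \<forall>n::nat. d \<ge> 1 \<and> n \<ge> 2 \<longrightarrow>
        ereal (c0 * min (real d) (ln (real n + 1))) \<le> Gamma_sup d n \<and>
        Gamma_sup d n \<le> ereal (min (2 * real d + 1 / 2) (1 + ln (real n - 1) / 4)) \<and>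
        min (2 * real d + 1 / 2) (1 + ln (real n - 1) / 4)
          \<le> C0 * min (real d) (ln (real n + 1))) \<and>
     (\<forall>d::nat. d \<ge> 1 \<longrightarrow>
        anytime_const d (A_star d) \<and> (\<forall>A. anytime_const d A \<longrightarrow> A_star d \<le> A) \<and>
        max 1 (1 / 4 * real_of_int \<lfloor>(real d - 1) / 2\<rfloor>) \<le> A_star d \<and>
        A_star d \<le> 2 * real d + 1 / 2) \<and>
     (\<exists>c>0. \<exists>C>0. \<forall>d::nat. d \<ge> 1 \<longrightarrow>
        c * real d \<le> A_star d \<and> A_star d \<le> C * real d)"
proof -
  have lower: "1 \<le> A_star d" "real ((d - 1) div 2) / 4 \<le> A_star d" if "d \<ge> 1" for d
    using anytime_const_ge_1 anytime_const_ge_quarter[of d "A_star d" "(d - 1) div 2"]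
      A_star_is_least(1)[OF that] that by auto
  have upper: "A_star d \<le> 2 * real d + 1 / 2" if "d \<ge> 1" for d
    using A_star_is_least(2)[OF that] anytime_const_dimension[OF that] by blast
  have floor: "real_of_int \<lfloor>(real d - 1) / 2\<rfloor> = real ((d - 1) div 2)" if "d \<ge> 1" for d
  proof -
    have "(real d - 1) / 2 = real (d - 1) / real 2" using that by (simp add: of_nat_diff)
    then show ?thesis by (simp only: floor_divide_of_nat_eq of_int_of_nat_eq)
  qed
  have "1 / 10 * real d \<le> A_star d" if "d \<ge> 1" for d
  proof -
    have "d \<le> 2 * ((d - 1) div 2) + 2" by simp
    then have "real d \<le> 2 * real ((d - 1) div 2) + 2" by linarith
    then show ?thesis using lower[OF that] by linarith
  qed
  moreover have "A_star d \<le> 5 / 2 * real d" if "d \<ge> 1" for d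
    using upper[OF that] that by simp
  ultimately have "\<exists>c>0. \<exists>C>0. \<forall>d::nat. d \<ge> 1 \<longrightarrow>
      c * real d \<le> A_star d \<and> A_star d \<le> C * real d"
    by (intro exI[of _ "1 / 10"] conjI exI[of _ "5 / 2"]) auto
  moreover have "\<exists>c0>0. \<exists>C0>0. \<forall>d::nat. \<forall>n::nat. d \<ge> 1 \<and> n \<ge> 2 \<longrightarrow>
        ereal (c0 * min (real d) (ln (real n + 1))) \<le> Gamma_sup d n \<and>
        Gamma_sup d n \<le> ereal (min (2 * real d + 1 / 2) (1 + ln (real n - 1) / 4)) \<and>
        min (2 * real d + 1 / 2) (1 + ln (real n - 1) / 4)
          \<le> C0 * min (real d) (ln (real n + 1))"
    using Gamma_sup_lower Gamma_sup_upper bounds_comparable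
    by (intro exI[of _ "1 / 40"] conjI exI[of _ "5 / 2"]) auto
  ultimately show ?thesis
    using A_star_is_least lower upper floor by simp
qed

end
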